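(* There exist constants $c_m^{(j)}$, $j=1,\ldots,N$, $m=1,\ldots,\sum_{i=1}^Nm_+(i,j)$, such that, with $$\tilde V(s)=(V_1(s),\ldots,V_N(s))^T,\qquad V_j(s)=\frac{\sum_{m=1}^{\sum_{i=1}^Nm_+(i,j)}c_m^{(j)}s^m}{\prod_{i=1}^Ng_{i,j}^+(s)},$$ and $H(s)$ the $N\times N$ matrix whose $(j,i)$ entry is $p_{i,j}\frac{f_{i,j}(s)}{g_{i,j}(s)}$, one has $$\tilde Z(s)=H(s)\tilde Z(as)+\tilde V(s),\qquad \tilde Z(s)=\sum_{n=0}^\infty\prod_{d=0}^{n-1}H(a^ds)\,\tilde V(a^ns)+\prod_{n=0}^\infty H(a^ns)\,\tilde\pi,\qquad\tilde Z(0)=\tilde\pi,$$ for all $s$ with $\mathrm{Re}(s)\ge0$ such that no $a^ns$, $n\ge0$, is a zero of any $g_{i,j}$.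
   Context: Let $E=\{1,\ldots,N\}$, $a\in(0,1)$. $(Y_n)_{n\ge0}$ is an irreducible discrete-time Markov chain on $E$ with transition matrix $P=(p_{i,j})$ and stationary distribution $\tilde\pi=(\pi_1,\ldots,\pi_N)^T$. The nonnegative process $W_n$ satisfies $W_{n+1}=[aW_n+S_n-A_{n+1}]^+$, $[x]^+=\max(0,x)$, with $S_n,A_{n+1}\ge0$. Given $Y_n$, the triple $(A_{n+1},S_n,Y_{n+1})$ is independent of the past (in particular of $W_n$), with $P(Y_{n+1}=j\mid Y_n=i)=p_{i,j}$, and given $Y_n=i,Y_{n+1}=j$ the vector $(S_n,A_{n+1})$ has a bivariate matrix-exponential distribution (rational joint Laplace–Stieltjes transform), so that the transform of the difference is rational: $$E\big(e^{-s(S_n-A_{n+1})}\mid Y_n=i,Y_{n+1}=j\big)=\frac{f_{i,j}(s)}{g_{i,j}(s)},$$ with $f_{i,j},g_{i,j}$ coprime polynomials (so $f_{i,j}(0)=g_{i,j}(0)\ne0$). $m_+(i,j)$ is the number of zeros (with multiplicity) of $g_{i,j}$ in $\mathrm{Re}(s)\ge0$, and $g_{i,j}^+(s)$ is the monic polynomial $\prod_{l}(s-s_l)$ over these zeros. For $\mathrm{Re}(s)\ge0$, $Z_i(s)=\lim_{n\to\infty}E(e^{-sW_n}1_{\{Y_n=i\}})$; it is assumed that these limits exist and are the transforms $E(e^{-sW}1_{\{Y=i\}})$ of a steady-state pair $(W,Y)$ with $W$ finite and $P(Y=i)=\pi_i$. $\tilde Z(s)=(Z_1(s),\ldots,Z_N(s))^T$.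 Matrix products are ordered with increasing index from left to right, empty products are the identity, and $\prod_{n=0}^\infty H(a^ns)\tilde\pi$ means $\lim_{n\to\infty}\prod_{m=0}^{n}H(a^ms)\tilde\pi$. *)

theory Defs
  imports "HOL-Probability.Probability" "HOL-Computational_Algebra.Computational_Algebra"
begin

text \<open>The state space \<open>E = {1, \<dots>, N}\<close> is a finite type \<open>'n\<close> with \<open>N = CARD('n)\<close>.\<close>

text \<open>\<open>mat_prod A n = A 0 ** A 1 ** \<dots> ** A (n - 1)\<close>. Note that \<open>*\<close>, \<open>^\<close> and \<open>prod\<close> on
  \<open>'a ^ 'n ^ 'n\<close> are componentwise.\<close>
primrec mat_prod :: "(nat \<Rightarrow> 'a::semiring_1 ^ 'n ^ 'n) \<Rightarrow> nat \<Rightarrow> 'a ^ 'n ^ 'n" where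
  "mat_prod A 0 = mat 1"
| "mat_prod A (Suc n) = mat_prod A n ** A n"

definition stochastic_matrix :: "real ^ 'n ^ 'n \<Rightarrow> bool" where
  "stochastic_matrix P \<longleftrightarrow> (\<forall>i j. 0 \<le> P $ i $ j) \<and> (\<forall>i. (\<Sum>j\<in>UNIV. P $ i $ j) = 1)"

definition irreducible_matrix :: "real ^ 'n ^ 'n \<Rightarrow> bool" where
  "irreducible_matrix P \<longleftrightarrow> (\<forall>i j. \<exists>n. 0 < mat_prod (\<lambda>_. P) n $ i $ j)"

definition stationary_distribution :: "real ^ 'n ^ 'n \<Rightarrow> real ^ 'n \<Rightarrow> bool" where
  "stationary_distribution P \<pi> \<longleftrightarrow>
     (\<forall>i. 0 \<le> \<pi> $ i) \<and> (\<Sum>i\<in>UNIV. \<pi> $ i) = 1 \<and> \<pi> v* P = \<pi>"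

text \<open>Evaluation of a bivariate polynomial, represented as a polynomial over polynomials.\<close>
definition poly2 :: "complex poly poly \<Rightarrow> complex \<Rightarrow> complex \<Rightarrow> complex" where
  "poly2 p s t = poly (poly p [:s:]) t"

text \<open>Rationality of the joint Laplace--Stieltjes transform is stated in product form, because
  coprime bivariate polynomials may still have common zeros on the boundary of the domain.\<close>
definition bivariate_matrix_exponential :: "(real \<times> real) measure \<Rightarrow> bool" where
  "bivariate_matrix_exponential \<mu> \<longleftrightarrow>
     prob_space \<mu> \<and> sets \<mu> = sets borel \<and> (AE (x, y) in \<mu>. 0 \<le> x \<and> 0 \<le> y) \<and>
     (\<exists>p q. q \<noteq> 0 \<and>
        (\<forall>s t. 0 \<le> Re s \<and> 0 \<le> Re t \<longrightarrow>
           poly2 q s t * (LINT (x, y)|\<mu>. exp (- s * of_real x - t * of_real y)) = poly2 p s t))"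

text \<open>The history up to time \<open>n\<close>; \<open>S k\<close> and \<open>A (Suc k)\<close> drive the step from \<open>k\<close> to \<open>Suc k\<close>.\<close>
definition past_events ::
  "'w measure \<Rightarrow> (nat \<Rightarrow> 'w \<Rightarrow> real) \<Rightarrow> (nat \<Rightarrow> 'w \<Rightarrow> 'n) \<Rightarrow> (nat \<Rightarrow> 'w \<Rightarrow> real) \<Rightarrow>
     (nat \<Rightarrow> 'w \<Rightarrow> real) \<Rightarrow> nat \<Rightarrow> 'w set set" where
  "past_events M W Y S A n = sigma_sets (space M)
     ({W k -` B \<inter> space M | k B. k \<le> n \<and> B \<in> sets borel} \<union>
      {Y k -` B \<inter> space M | k B. k \<le> n} \<union>
      {S k -` B \<inter> space M | k B. k < n \<and> B \<in> sets borel} \<union>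
      {A (Suc k) -` B \<inter> space M | k B. k < n \<and> B \<in> sets borel})"

definition transform_on :: "'w measure \<Rightarrow> ('w \<Rightarrow> real) \<Rightarrow> ('w \<Rightarrow> 'n) \<Rightarrow> 'n \<Rightarrow> complex \<Rightarrow> complex" where
  "transform_on M X U i s = (LINT \<omega>|M. exp (- s * of_real (X \<omega>)) * of_bool (U \<omega> = i))"

definition Z_vec ::
  "'w measure \<Rightarrow> (nat \<Rightarrow> 'w \<Rightarrow> real) \<Rightarrow> (nat \<Rightarrow> 'w \<Rightarrow> 'n::finite) \<Rightarrow> complex \<Rightarrow> complex ^ 'n" where
  "Z_vec M W Y s = (\<chi> i. lim (\<lambda>n. transform_on M (W n) (Y n) i s))"

definition m_plus :: "complex poly \<Rightarrow> nat" where
  "m_plus g = (\<Sum>z | poly g z = 0 \<and> 0 \<le> Re z. order z g)"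

definition g_plus :: "complex poly \<Rightarrow> complex poly" where
  "g_plus g = (\<Prod>z | poly g z = 0 \<and> 0 \<le> Re z. [:- z, 1:] ^ order z g)"

definition V_vec ::
  "('n::finite \<Rightarrow> 'n \<Rightarrow> complex poly) \<Rightarrow> ('n \<Rightarrow> nat \<Rightarrow> complex) \<Rightarrow> complex \<Rightarrow> complex ^ 'n" where
  "V_vec g c s = (\<chi> j. (\<Sum>m = 1..(\<Sum>i\<in>UNIV. m_plus (g i j)). c j m * s ^ m) /
                         (\<Prod>i\<in>UNIV. poly (g_plus (g i j)) s))"

text \<open>Rows are indexed by the new state \<open>j\<close>, columns by the old state \<open>i\<close>.\<close>
definition H_mat ::
  "real ^ 'n ^ 'n \<Rightarrow> ('n::finite \<Rightarrow> 'n \<Rightarrow> complex poly) \<Rightarrow> ('n \<Rightarrow> 'n \<Rightarrow> complex poly) \<Rightarrow>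
     complex \<Rightarrow> complex ^ 'n ^ 'n" where
  "H_mat P f g s = (\<chi> j i. of_real (P $ i $ j) * (poly (f i j) s / poly (g i j) s))"

definition complex_vec :: "real ^ 'n \<Rightarrow> complex ^ 'n" where
  "complex_vec x = (\<chi> i. of_real (x $ i))"

end

theory Submission
  imports Defs "HOL-Complex_Analysis.Complex_Analysis"
begin

text \<open>
The recursion conditions on the state before a step and, on the imaginary axis, splits the transform of
\<open>max 0 (a W + S - A)\<close> as \<open>exp (- s max 0 t) = exp (- s t) + (1 - exp (- s min 0 t))\<close>. By the conditional
independence the first part is \<open>H(s) Z(as)\<close>; the second part, the overshoot below 0, defines a vector
\<open>U(s)\<close>. The limit \<open>n \<rightarrow> \<infinity>\<close> can be taken because the overshoot, as a function of the value
before the step, is continuous and vanishes at infinity; such functions are continuous functions of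
\<open>exp (- W)\<close> on \<open>[0, 1]\<close>, for which convergence of the transforms at \<open>0, 1, 2, \<dots>\<close> suffices by
Weierstrass approximation (\<open>integral_convergence_of_laplace\<close>, \<open>transition_transform\<close>).

The resulting equation \<open>Z(s) = H(s) Z(as) + U(s)\<close> on the imaginary axis is a Wiener--Hopf problem.
The function \<open>U\<close> is bounded and holomorphic in \<open>Re s < 0\<close>. The other terms are holomorphic in
\<open>Re s > 0\<close> except for poles at zeros of the \<open>g i j\<close>, and they are bounded near infinity because
\<open>f i j / g i j\<close> is a characteristic function on the axis. After multiplication with the product of the
\<open>g_plus (g i j)\<close> the two sides glue to an entire function of polynomial growth, hence to a polynomial,
and it vanishes at 0 since \<open>U\<close> does. Divided by that product, it is the vector \<open>V\<close> (\<open>boundary_solution\<close>).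

Finally the equation is iterated. The matrix \<open>H(0)\<close> is the transpose of \<open>P\<close>, which does not
increase the sum norm and fixes the stationary vector, and \<open>H(a^m s)\<close> differs from it by \<open>O(a^m)\<close>. So the matrix
products stay bounded, the infinite product applied to the stationary vector converges, and so does the
series, since \<open>Z(a^n s)\<close> tends to \<open>Z(0) = \<pi>\<close> (\<open>iteration_limit\<close>).
\<close>

section \<open>Laplace transforms of nonnegative variables\<close>

definition laplace :: "'a measure \<Rightarrow> ('a \<Rightarrow> real) \<Rightarrow> complex \<Rightarrow> complex" where
  "laplace N X s = (LINT \<omega>|N. exp (- s * of_real (X \<omega>)))"

lemma norm_exp_laplace_le:
  assumes "0 \<le> Re s" "0 \<le> x"
  shows "norm (exp (- s * complex_of_real x)) \<le> 1"
  using assms by (simp add: norm_exp_eq_Re)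

lemma integrable_laplace:
  assumes "finite_measure N" and X: "X \<in> borel_measurable N"
    and nonneg: "\<And>\<omega>. \<omega> \<in> space N \<Longrightarrow> 0 \<le> X \<omega>" and s: "0 \<le> Re s"
  shows "integrable N (\<lambda>\<omega>. exp (- s * complex_of_real (X \<omega>)))"
proof -
  interpret finite_measure N by fact
  show ?thesis
    by (rule integrable_const_bound[where B = 1])
      (use X nonneg s in \<open>auto intro!: AE_I2 norm_exp_laplace_le\<close>)
qed

lemma norm_integral_le_measure:
  fixes h :: "'a \<Rightarrow> complex"
  assumes "finite_measure N" and "\<And>\<omega>. \<omega> \<in> space N \<Longrightarrow> norm (h \<omega>) \<le> B" and "0 \<le> B"
  shows "norm (LINT \<omega>|N. h \<omega>) \<le> B * measure N (space N)"
proof -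
  interpret finite_measure N by fact
  have "norm (LINT \<omega>|N. h \<omega>) \<le> (LINT \<omega>|N. norm (h \<omega>))"
    by (rule integral_norm_bound)
  also have "\<dots> \<le> (LINT \<omega>|N. B)"
    by (rule integral_mono_AE') (use assms in \<open>auto intro!: AE_I2\<close>)
  finally show ?thesis by (simp add: mult.commute)
qed

lemma norm_laplace_le:
  assumes "finite_measure N" and "\<And>\<omega>. \<omega> \<in> space N \<Longrightarrow> 0 \<le> X \<omega>" and "0 \<le> Re s"
  shows "norm (laplace N X s) \<le> measure N (space N)"
  using norm_integral_le_measure[OF assms(1), of "\<lambda>\<omega>. exp (- s * complex_of_real (X \<omega>))" 1]
    norm_exp_laplace_le assms by (auto simp: laplace_def)

text \<open>Continuity up to the imaginary axis needs no moments: on the closed half-plane all integrands are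
bounded by 1, which is integrable against a finite measure.\<close>

lemma continuous_on_laplace:
  assumes "finite_measure N" and X: "X \<in> borel_measurable N"
    and nonneg: "\<And>\<omega>. \<omega> \<in> space N \<Longrightarrow> 0 \<le> X \<omega>"
  shows "continuous_on {s. 0 \<le> Re s} (laplace N X)"
proof (rule continuous_on_sequentiallyI)
  interpret finite_measure N by fact
  fix u :: "nat \<Rightarrow> complex" and s
  assume u: "\<forall>n. u n \<in> {s. 0 \<le> Re s}" "s \<in> {s. 0 \<le> Re s}" "u \<longlonglongrightarrow> s"
  show "(\<lambda>n. laplace N X (u n)) \<longlonglongrightarrow> laplace N X s"
    unfolding laplace_def
  proof (rule integral_dominated_convergence[where w = "\<lambda>_. 1"])
    show "AE \<omega> in N. (\<lambda>n. exp (- u n * complex_of_real (X \<omega>)))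
        \<longlonglongrightarrow> exp (- s * complex_of_real (X \<omega>))"
      by (intro AE_I2 tendsto_intros u)
    show "AE \<omega> in N. norm (exp (- u n * complex_of_real (X \<omega>))) \<le> 1" for n
      using u nonneg by (intro AE_I2 norm_exp_laplace_le) auto
  qed (use X in auto)
qed

text \<open>Differentiation under the integral sign. In the open half-plane the exponential decay beats the
factor \<open>X\<close> that the derivative produces, again without any moment condition.\<close>

lemma holomorphic_on_laplace:
  assumes "finite_measure N" and X: "X \<in> borel_measurable N"
    and nonneg: "\<And>\<omega>. \<omega> \<in> space N \<Longrightarrow> 0 \<le> X \<omega>"
  shows "laplace N X holomorphic_on {s. 0 < Re s}"
proof (subst holomorphic_on_open)
  interpret finite_measure N by fact
  show "open {s. 0 < Re s}"
    by (simp add: open_halfspace_Re_gt)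
  show "\<forall>s\<in>{s. 0 < Re s}. \<exists>D. (laplace N X has_field_derivative D) (at s)"
  proof
    fix s assume "s \<in> {s. 0 < Re s}"
    then have s: "0 < Re s" by simp
    define r where "r = Re s / 2"
    define D where "D = (LINT \<omega>|N. - complex_of_real (X \<omega>) * exp (- s * complex_of_real (X \<omega>)))"
    define C where "C = {z. r \<le> Re z}"
    have r: "0 < r" and sC: "s \<in> C" using s by (auto simp: r_def C_def)
    have "convex C" unfolding C_def by (rule convex_halfspace_Re_ge)
    \<comment> \<open>\<open>x exp (- r x)\<close> is bounded on \<open>x \<ge> 0\<close>, which makes the difference quotients dominated.\<close>
    have lip: "norm (exp (- z * complex_of_real x) - exp (- s * complex_of_real x)) \<le> (1 / r) * norm (z - s)"
      if "z \<in> C" "0 \<le> x" for z x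
    proof (rule field_differentiable_bound[where f' = "\<lambda>z. - complex_of_real x * exp (- z * complex_of_real x)"])
      show "convex C" by fact
      fix y assume "y \<in> C"
      show "((\<lambda>z. exp (- z * complex_of_real x)) has_field_derivative
          - complex_of_real x * exp (- y * complex_of_real x)) (at y within C)"
        by (auto intro!: derivative_eq_intros)
      have "r * x \<le> exp (r * x)" using exp_ge_add_one_self[of "r * x"] by linarith
      moreover have "exp (r * x) \<le> exp (Re y * x)"
        using \<open>y \<in> C\<close> \<open>0 \<le> x\<close> by (auto simp: C_def mult_right_mono)
      ultimately have "r * x \<le> exp (Re y * x)" by linarith
      then have "(r * x) / exp (Re y * x) \<le> 1" by simp
      moreover have "(r * x) / exp (Re y * x) = (x * exp (- (Re y * x))) * r"
        by (simp add: exp_minus divide_inverse)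
      ultimately have "x * exp (- (Re y * x)) \<le> 1 / r"
        using r by (simp add: pos_le_divide_eq)
      then show "norm (- complex_of_real x * exp (- y * complex_of_real x)) \<le> 1 / r"
        using \<open>0 \<le> x\<close> by (simp add: norm_mult norm_exp_eq_Re)
    qed (use that sC in auto)
    have "((\<lambda>z. (laplace N X z - laplace N X s) / (z - s)) \<longlongrightarrow> D) (at s)"
    proof (subst tendsto_at_iff_sequentially, intro allI impI, unfold comp_def)
      fix u :: "nat \<Rightarrow> complex"
      assume u: "\<forall>i. u i \<in> UNIV - {s}" "u \<longlonglongrightarrow> s"
      have "eventually (\<lambda>n. u n \<in> {z. r < Re z}) sequentially"
        using s by (intro topological_tendstoD[OF u(2)] open_halfspace_Re_gt) (auto simp: r_def)
      then obtain n0 where n0: "\<And>n. n \<ge> n0 \<Longrightarrow> u n \<in> C"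
        by (auto simp: eventually_sequentially C_def intro: less_imp_le)
      define v where "v n = u (n + n0)" for n
      have v: "v n \<in> C" "v n \<noteq> s" "0 \<le> Re (v n)" for n
        using u n0[of "n + n0"] r by (auto simp: v_def C_def)
      have vlim: "v \<longlonglongrightarrow> s" unfolding v_def by (rule LIMSEQ_ignore_initial_segment[OF u(2)])
      let ?q = "\<lambda>n \<omega>. (exp (- v n * complex_of_real (X \<omega>)) - exp (- s * complex_of_real (X \<omega>))) / (v n - s)"
      have "(\<lambda>n. LINT \<omega>|N. ?q n \<omega>) \<longlonglongrightarrow> D"
        unfolding D_def
      proof (rule integral_dominated_convergence[where w = "\<lambda>_. 1 / r"])
        show "AE \<omega> in N. (\<lambda>n. ?q n \<omega>) \<longlonglongrightarrow> - complex_of_real (X \<omega>) * exp (- s * complex_of_real (X \<omega>))"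
        proof (intro AE_I2)
          fix \<omega>
          have "((\<lambda>z. exp (- z * complex_of_real (X \<omega>))) has_field_derivative
             - complex_of_real (X \<omega>) * exp (- s * complex_of_real (X \<omega>))) (at s)"
            by (auto intro!: derivative_eq_intros)
          then have "((\<lambda>z. (exp (- z * complex_of_real (X \<omega>)) - exp (- s * complex_of_real (X \<omega>))) / (z - s))
             \<longlongrightarrow> - complex_of_real (X \<omega>) * exp (- s * complex_of_real (X \<omega>))) (at s)"
            by (simp add: has_field_derivative_iff)
          then show "(\<lambda>n. ?q n \<omega>) \<longlonglongrightarrow> - complex_of_real (X \<omega>) * exp (- s * complex_of_real (X \<omega>))"
            using v vlim by (subst (asm) tendsto_at_iff_sequentially) (auto simp: comp_def)
        qed
        show "AE \<omega> in N. norm (?q n \<omega>) \<le> 1 / r" for n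
          using lip[OF v(1)[of n]] nonneg v(2)[of n] by (intro AE_I2) (simp add: norm_divide pos_divide_le_eq)
      qed (use X in auto)
      moreover have "(LINT \<omega>|N. ?q n \<omega>) = (laplace N X (v n) - laplace N X s) / (v n - s)" for n
        using integrable_laplace[OF \<open>finite_measure N\<close> X nonneg] v s
        by (simp add: laplace_def Bochner_Integration.integral_diff)
      ultimately have "(\<lambda>n. (laplace N X (v n) - laplace N X s) / (v n - s)) \<longlonglongrightarrow> D"
        by (simp only:)
      then show "(\<lambda>n. (laplace N X (u n) - laplace N X s) / (u n - s)) \<longlonglongrightarrow> D"
        unfolding v_def by (rule LIMSEQ_offset)
    qed
    then show "\<exists>D. (laplace N X has_field_derivative D) (at s)"
      by (auto simp: has_field_derivative_iff)
  qed
qed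

lemma laplace_0: "laplace N X 0 = of_real (measure N (space N))"
  by (simp add: laplace_def scaleR_conv_of_real)

section \<open>Convergence of integrals from convergence of transforms\<close>

text \<open>A moment theorem on \<open>[0, 1]\<close>: polynomials are uniformly dense in the continuous functions, so
convergence of all moments gives convergence of all integrals of continuous functions. The moment of
order 0 bounds the total masses uniformly, which keeps the approximation error under control.\<close>

lemma real_moment_convergence:
  fixes N :: "nat \<Rightarrow> 'a measure" and N' :: "'b measure"
    and X :: "nat \<Rightarrow> 'a \<Rightarrow> real" and X' :: "'b \<Rightarrow> real" and \<psi> :: "real \<Rightarrow> real"
  assumes N: "\<And>n. finite_measure (N n)" "finite_measure N'"
    and X: "\<And>n. X n \<in> borel_measurable (N n)" "X' \<in> borel_measurable N'"
    and range: "\<And>n \<omega>. \<omega> \<in> space (N n) \<Longrightarrow> X n \<omega> \<in> {0..1}"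
      "\<And>\<omega>. \<omega> \<in> space N' \<Longrightarrow> X' \<omega> \<in> {0..1}"
    and moments: "\<And>k. (\<lambda>n. LINT \<omega>|N n. X n \<omega> ^ k) \<longlonglongrightarrow> (LINT \<omega>|N'. X' \<omega> ^ k)"
    and \<psi>: "continuous_on {0..1} \<psi>"
  shows "(\<lambda>n. LINT \<omega>|N n. \<psi> (X n \<omega>)) \<longlonglongrightarrow> (LINT \<omega>|N'. \<psi> (X' \<omega>))"
proof -
  have meas: "(\<lambda>\<omega>. \<phi> (Y \<omega>)) \<in> borel_measurable K"
    if "Y \<in> borel_measurable K" "\<And>\<omega>. \<omega> \<in> space K \<Longrightarrow> Y \<omega> \<in> {0..1}" "continuous_on {0..1} \<phi>"
    for \<phi> :: "real \<Rightarrow> real" and Y and K :: "'c measure"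
  proof -
    have "Y \<in> measurable K (restrict_space borel {0..1})"
      using that by (intro measurable_restrict_space2) auto
    from measurable_compose[OF this borel_measurable_continuous_on_restrict[OF that(3)]]
    show ?thesis .
  qed
  have int: "integrable K (\<lambda>\<omega>. \<phi> (Y \<omega>))"
    if "finite_measure K" "Y \<in> borel_measurable K" "\<And>\<omega>. \<omega> \<in> space K \<Longrightarrow> Y \<omega> \<in> {0..1}"
      "continuous_on {0..1} \<phi>"
    for \<phi> :: "real \<Rightarrow> real" and Y and K :: "'c measure"
  proof -
    interpret K: finite_measure K by fact
    have "bounded (\<phi> ` {0..1})"
      using that(4) by (intro compact_imp_bounded compact_continuous_image) auto
    then obtain B where "\<forall>t\<in>{0..1}. norm (\<phi> t) \<le> B"
      by (auto simp: bounded_iff)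
    then have "AE \<omega> in K. norm (\<phi> (Y \<omega>)) \<le> B"
      using that(3) by (intro AE_I2) auto
    then show ?thesis
      by (rule K.integrable_const_bound) (rule meas[OF that(2-4)])
  qed
  have mass: "(\<lambda>n. measure (N n) (space (N n))) \<longlonglongrightarrow> measure N' (space N')"
    using moments[of 0] by simp
  then have "Bseq (\<lambda>n. measure (N n) (space (N n)))"
    by (intro convergent_imp_Bseq) (auto simp: convergent_def)
  then obtain B where B: "0 < B" "\<And>n. measure (N n) (space (N n)) \<le> B"
    by (auto simp: Bseq_def)
  have B': "measure N' (space N') \<le> B"
    by (rule LIMSEQ_le_const2[OF mass]) (use B(2) in auto)
  show ?thesis
  proof (rule LIMSEQ_I)
    fix e :: real assume "0 < e"
    define d where "d = e / (3 * B)"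
    have "0 < d" using \<open>0 < e\<close> B by (simp add: d_def)
    obtain p where p: "real_polynomial_function p" "\<And>t. t \<in> {0..1} \<Longrightarrow> \<bar>\<psi> t - p t\<bar> < d"
      using Stone_Weierstrass_real_polynomial_function[OF _ \<psi> \<open>0 < d\<close>] by auto
    have contp: "continuous_on {0..1} p"
      using p(1) by (intro continuous_on_polymonial_function) (simp add: real_polynomial_function_eq)
    obtain c m where pc: "p = (\<lambda>t. \<Sum>i\<le>m. c i * t ^ i)"
      using p(1) by (auto simp: real_polynomial_function_iff_sum)
    have close: "\<bar>(LINT \<omega>|K. \<psi> (Y \<omega>)) - (LINT \<omega>|K. p (Y \<omega>))\<bar> \<le> e / 3"
      if "finite_measure K" "Y \<in> borel_measurable K" "\<And>\<omega>. \<omega> \<in> space K \<Longrightarrow> Y \<omega> \<in> {0..1}"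
        "measure K (space K) \<le> B" for Y and K :: "'c measure"
    proof -
      interpret K: finite_measure K by fact
      have "(LINT \<omega>|K. \<psi> (Y \<omega>)) - (LINT \<omega>|K. p (Y \<omega>)) = (LINT \<omega>|K. \<psi> (Y \<omega>) - p (Y \<omega>))"
        using int[OF that(1-3) \<psi>] int[OF that(1-3) contp] by simp
      also have "\<bar>\<dots>\<bar> \<le> (LINT \<omega>|K. \<bar>\<psi> (Y \<omega>) - p (Y \<omega>)\<bar>)"
        using integral_norm_bound[of K "\<lambda>\<omega>. \<psi> (Y \<omega>) - p (Y \<omega>)"] by simp
      also have "\<dots> \<le> (LINT \<omega>|K. d)"
        by (rule integral_mono_AE') (use p(2) that(3) \<open>0 < d\<close> in \<open>auto intro!: AE_I2 less_imp_le\<close>)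
      also have "\<dots> = measure K (space K) * d" by simp
      also have "\<dots> \<le> B * d" using that(4) \<open>0 < d\<close> by (intro mult_right_mono) auto
      also have "\<dots> = e / 3" using B by (simp add: d_def)
      finally show ?thesis .
    qed
    have poly: "(LINT \<omega>|K. p (Y \<omega>)) = (\<Sum>i\<le>m. c i * (LINT \<omega>|K. Y \<omega> ^ i))"
      if "finite_measure K" "Y \<in> borel_measurable K" "\<And>\<omega>. \<omega> \<in> space K \<Longrightarrow> Y \<omega> \<in> {0..1}"
      for Y and K :: "'c measure"
    proof -
      have "integrable K (\<lambda>\<omega>. Y \<omega> ^ i)" for i
        by (rule int[OF that]) (auto intro!: continuous_intros)
      then show ?thesis by (simp add: pc)
    qed
    have "(\<lambda>n. LINT \<omega>|N n. p (X n \<omega>)) \<longlonglongrightarrow> (LINT \<omega>|N'. p (X' \<omega>))"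
      using N X range by (simp add: poly) (intro tendsto_intros moments)
    from LIMSEQ_D[OF this, of "e / 3"] \<open>0 < e\<close>
    obtain n0 where n0: "\<And>n. n \<ge> n0 \<Longrightarrow> norm ((LINT \<omega>|N n. p (X n \<omega>)) - (LINT \<omega>|N'. p (X' \<omega>))) < e / 3"
      by auto
    have "norm ((LINT \<omega>|N n. \<psi> (X n \<omega>)) - (LINT \<omega>|N'. \<psi> (X' \<omega>))) < e" if "n \<ge> n0" for n
    proof -
      have 1: "\<bar>(LINT \<omega>|N n. \<psi> (X n \<omega>)) - (LINT \<omega>|N n. p (X n \<omega>))\<bar> \<le> e / 3"
        by (rule close) (use N X range B in auto)
      have 2: "\<bar>(LINT \<omega>|N'. \<psi> (X' \<omega>)) - (LINT \<omega>|N'. p (X' \<omega>))\<bar> \<le> e / 3"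
        by (rule close) (use N X range B' in auto)
      show ?thesis using 1 2 n0[OF that] unfolding real_norm_def by linarith
    qed
    then show "\<exists>no. \<forall>n\<ge>no. norm ((LINT \<omega>|N n. \<psi> (X n \<omega>)) - (LINT \<omega>|N'. \<psi> (X' \<omega>))) < e"
      by blast
  qed
qed

lemma laplace_of_nat:
  "laplace N X (of_nat k) = of_real (LINT \<omega>|N. exp (- X \<omega>) ^ k)"
proof -
  have "exp (- of_nat k * complex_of_real x) = complex_of_real (exp (- x) ^ k)" for x
    by (simp add: exp_of_real[symmetric] exp_of_nat_mult[symmetric])
  then show ?thesis by (simp only: laplace_def integral_complex_of_real)
qed

text \<open>Weak convergence out of Laplace transforms. The values at \<open>0, 1, 2, \<dots>\<close> are the moments of
\<open>exp (- X)\<close>, and a continuous function that vanishes at infinity is a continuous function of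
\<open>exp (- X)\<close> on \<open>[0, 1]\<close>. This replaces the continuity theorem for characteristic functions, and it
applies directly to measures that are not normalized.\<close>

lemma integral_convergence_of_laplace:
  fixes N :: "nat \<Rightarrow> 'a measure" and N' :: "'b measure"
    and X :: "nat \<Rightarrow> 'a \<Rightarrow> real" and X' :: "'b \<Rightarrow> real" and h :: "real \<Rightarrow> complex"
  assumes N: "\<And>n. finite_measure (N n)" "finite_measure N'"
    and X: "\<And>n. X n \<in> borel_measurable (N n)" "X' \<in> borel_measurable N'"
    and nonneg: "\<And>n \<omega>. \<omega> \<in> space (N n) \<Longrightarrow> 0 \<le> X n \<omega>" "\<And>\<omega>. \<omega> \<in> space N' \<Longrightarrow> 0 \<le> X' \<omega>"
    and laplace: "\<And>k. (\<lambda>n. laplace (N n) (X n) (of_nat k)) \<longlonglongrightarrow> laplace N' X' (of_nat k)"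
    and h: "continuous_on {0..} h" "(h \<longlongrightarrow> 0) at_top"
  shows "(\<lambda>n. LINT \<omega>|N n. h (X n \<omega>)) \<longlonglongrightarrow> (LINT \<omega>|N'. h (X' \<omega>))"
proof -
  (* The substitution t = exp (- x) sends infinity to 0, where the limit of h is the value. *)
  define \<psi> where "\<psi> t = (if t = 0 then 0 else h (- ln t))" for t :: real
  have \<psi>_exp: "\<psi> (exp (- x)) = h x" for x by (simp add: \<psi>_def)
  have cont: "continuous_on {0..1} \<psi>"
    unfolding continuous_on
  proof
    fix t :: real assume t: "t \<in> {0..1}"
    show "(\<psi> \<longlongrightarrow> \<psi> t) (at t within {0..1})"
    proof (cases "t = 0")
      case True
      have "filterlim (\<lambda>t::real. - ln t) at_top (at_right 0)"
        using ln_at_0 by (simp add: filterlim_uminus_at_top)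
      then have "((\<lambda>t. h (- ln t)) \<longlongrightarrow> 0) (at_right 0)"
        by (rule filterlim_compose[OF h(2)])
      moreover have "eventually (\<lambda>t. h (- ln t) = \<psi> t) (at_right 0)"
        by (auto simp: eventually_at_filter \<psi>_def)
      ultimately have "(\<psi> \<longlongrightarrow> 0) (at_right 0)" by (rule Lim_transform_eventually)
      then have "(\<psi> \<longlongrightarrow> 0) (at 0 within {0..1})"
        by (simp add: at_within_Icc_at_right)
      then show ?thesis using True by (simp add: \<psi>_def)
    next
      case False
      then have t0: "0 < t" using t by simp
      have "continuous_on {0<..1} (\<lambda>t. h (- ln t))"
        by (rule continuous_on_compose2[OF h(1)]) (auto intro!: continuous_intros)
      then have "((\<lambda>t. h (- ln t)) \<longlongrightarrow> h (- ln t)) (at t within {0<..1})"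
        using t t0 by (auto simp: continuous_on)
      moreover have "at t within {0<..1} = at t within {0..1}"
        by (rule at_within_nhd[of _ "{0<..}"]) (use t0 in auto)
      ultimately have "((\<lambda>t. h (- ln t)) \<longlongrightarrow> h (- ln t)) (at t within {0..1})" by simp
      moreover have "eventually (\<lambda>t. h (- ln t) = \<psi> t) (at t within {0..1})"
        using order_tendstoD(1)[OF tendsto_ident_at t0]
        by (rule eventually_mono) (simp add: \<psi>_def)
      ultimately have "(\<psi> \<longlongrightarrow> h (- ln t)) (at t within {0..1})"
        by (rule Lim_transform_eventually)
      then show ?thesis using False by (simp add: \<psi>_def)
    qed
  qed
  have moments: "(\<lambda>n. LINT \<omega>|N n. exp (- X n \<omega>) ^ k) \<longlonglongrightarrow> (LINT \<omega>|N'. exp (- X' \<omega>) ^ k)" for k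
    using laplace[of k] unfolding laplace_of_nat by (simp only: tendsto_of_real_iff)
  have bdd: "bounded (\<psi> ` {0..1})"
    by (intro compact_imp_bounded compact_continuous_image cont) auto
  then obtain B where B: "\<forall>t\<in>{0..1}. norm (\<psi> t) \<le> B"
    by (auto simp: bounded_iff)
  have hB: "norm (h x) \<le> B" if "0 \<le> x" for x
    using bspec[OF B, of "exp (- x)"] that by (simp add: \<psi>_exp)
  have int: "integrable K (\<lambda>\<omega>. h (Y \<omega>))"
    if "finite_measure K" "Y \<in> borel_measurable K" "\<And>\<omega>. \<omega> \<in> space K \<Longrightarrow> 0 \<le> Y \<omega>"
    for Y and K :: "'c measure"
  proof -
    interpret K: finite_measure K by fact
    have "Y \<in> measurable K (restrict_space borel {0..})"
      using that by (intro measurable_restrict_space2) auto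
    from measurable_compose[OF this borel_measurable_continuous_on_restrict[OF h(1)]]
    show ?thesis
      using that hB by (intro K.integrable_const_bound[where B = B] AE_I2) auto
  qed
  have conv: "(\<lambda>n. LINT \<omega>|N n. \<phi> (\<psi> (exp (- X n \<omega>)))) \<longlonglongrightarrow> (LINT \<omega>|N'. \<phi> (\<psi> (exp (- X' \<omega>))))"
    if "continuous_on UNIV \<phi>" for \<phi> :: "complex \<Rightarrow> real"
  proof (rule real_moment_convergence[where \<psi> = "\<lambda>t. \<phi> (\<psi> t)" and X = "\<lambda>n \<omega>. exp (- X n \<omega>)"])
    show "continuous_on {0..1} (\<lambda>t. \<phi> (\<psi> t))"
      by (rule continuous_on_compose2[OF that cont]) auto
    show "(\<lambda>n. LINT \<omega>|N n. exp (- X n \<omega>) ^ k) \<longlonglongrightarrow> (LINT \<omega>|N'. exp (- X' \<omega>) ^ k)" for k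
      by (rule moments)
  qed (use N X nonneg in auto)
  have Re: "(\<lambda>n. LINT \<omega>|N n. Re (h (X n \<omega>))) \<longlonglongrightarrow> (LINT \<omega>|N'. Re (h (X' \<omega>)))"
    using conv[of Re] by (simp add: \<psi>_exp continuous_on_Re)
  have Im: "(\<lambda>n. LINT \<omega>|N n. Im (h (X n \<omega>))) \<longlonglongrightarrow> (LINT \<omega>|N'. Im (h (X' \<omega>)))"
    using conv[of Im] by (simp add: \<psi>_exp continuous_on_Im)
  show ?thesis
    unfolding tendsto_complex_iff
    using Re Im int[OF N(1) X(1) nonneg(1)] int[OF N(2) X(2) nonneg(2)] by simp
qed

section \<open>Restriction to a state and product laws\<close>

definition on_state :: "'w measure \<Rightarrow> ('w \<Rightarrow> 'n) \<Rightarrow> 'n \<Rightarrow> 'w measure" where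
  "on_state M U i = restrict_space M {\<omega> \<in> space M. U \<omega> = i}"

lemma state_event:
  assumes "U \<in> measurable M (count_space UNIV)"
  shows "{\<omega> \<in> space M. U \<omega> = i} \<in> sets M"
  using measurable_sets[OF assms, of "{i}"] by (simp add: vimage_def Int_def conj_commute)

lemma space_on_state: "space (on_state M U i) = {\<omega> \<in> space M. U \<omega> = i}"
  by (auto simp: on_state_def space_restrict_space)

lemma finite_measure_on_state:
  assumes "finite_measure M" "U \<in> measurable M (count_space UNIV)"
  shows "finite_measure (on_state M U i)"
  unfolding on_state_def by (rule finite_measure_restrict_space[OF assms(1) state_event[OF assms(2)]])

lemma measurable_on_state: "X \<in> measurable M K \<Longrightarrow> X \<in> measurable (on_state M U i) K"
  unfolding on_state_def by (rule measurable_restrict_space1)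

lemma integral_on_state:
  fixes h :: "'w \<Rightarrow> complex"
  assumes "U \<in> measurable M (count_space UNIV)"
  shows "(LINT \<omega>|on_state M U i. h \<omega>) = (LINT \<omega>|M. h \<omega> * of_bool (U \<omega> = i))"
  unfolding on_state_def
  using state_event[OF assms, of i]
  by (subst integral_restrict_space)
    (auto intro!: Bochner_Integration.integral_cong simp: indicator_def)

lemma emeasure_on_state:
  assumes "U \<in> measurable M (count_space UNIV)" "D \<in> sets M"
  shows "emeasure (on_state M U i) (D \<inter> space (on_state M U i)) = emeasure M {\<omega> \<in> D. U \<omega> = i}"
proof -
  have "D \<inter> {\<omega> \<in> space M. U \<omega> = i} = {\<omega> \<in> D. U \<omega> = i}"
    using sets.sets_into_space[OF assms(2)] by auto
  then show ?thesis
    unfolding space_on_state using sets.Int[OF state_event[OF assms(1), of i] sets.top]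
    unfolding on_state_def by (subst emeasure_restrict_space) auto
qed

lemma transform_on_eq_laplace:
  assumes "U \<in> measurable M (count_space UNIV)"
  shows "transform_on M X U i s = laplace (on_state M U i) X s"
  unfolding transform_on_def laplace_def integral_on_state[OF assms] ..

text \<open>The hypothesis compares probabilities of rectangles; these determine the law. Given \<open>U = i\<close> and
\<open>U' = j\<close>, the increment \<open>(S, A)\<close> is therefore independent of \<open>W\<close>, with the factor \<open>p\<close> accounting for
the probability of the transition.\<close>

lemma joint_law_product:
  fixes W S A :: "'w \<Rightarrow> real" and U U' :: "'w \<Rightarrow> 'n" and \<kappa> :: "(real \<times> real) measure" and p :: real
  assumes M: "prob_space M"
    and meas: "W \<in> borel_measurable M" "S \<in> borel_measurable M" "A \<in> borel_measurable M"
      "U \<in> measurable M (count_space UNIV)" "U' \<in> measurable M (count_space UNIV)"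
    and \<kappa>: "prob_space \<kappa>" "sets \<kappa> = sets borel" and p: "0 \<le> p"
    and rect: "\<And>B D. B \<in> sets borel \<Longrightarrow> D \<in> sets borel \<Longrightarrow>
       measure M {\<omega> \<in> space M. W \<omega> \<in> B \<and> (S \<omega>, A \<omega>) \<in> D \<and> U \<omega> = i \<and> U' \<omega> = j} =
       p * measure M {\<omega> \<in> space M. W \<omega> \<in> B \<and> U \<omega> = i} * measure \<kappa> D"
  shows "distr (on_state (on_state M U' j) U i) (borel \<Otimes>\<^sub>M \<kappa>) (\<lambda>\<omega>. (W \<omega>, (S \<omega>, A \<omega>))) =
     density (distr (on_state M U i) borel W) (\<lambda>_. p) \<Otimes>\<^sub>M \<kappa>"
proof -
  interpret M: prob_space M by fact
  interpret \<kappa>: prob_space \<kappa> by fact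
  let ?N = "on_state M U i"
  let ?D = "density (distr ?N borel W) (\<lambda>_. p)"
  let ?J = "on_state (on_state M U' j) U i"
  have finN: "finite_measure ?N"
    by (rule finite_measure_on_state[OF M.finite_measure_axioms meas(4)])
  interpret N: finite_measure ?N by (rule finN)
  have WN: "W \<in> borel_measurable ?N" by (rule measurable_on_state[OF meas(1)])
  interpret dist: finite_measure "distr ?N borel W" by (rule N.finite_measure_distr[OF WN])
  have finD: "finite_measure ?D"
    by (rule finite_measureI)
      (simp add: emeasure_density_const ennreal_mult_eq_top_iff dist.emeasure_finite)
  interpret D: finite_measure ?D by (rule finD)
  note [measurable_cong] = \<kappa>(2)
  note [measurable] = meas
  have SA: "(\<lambda>\<omega>. (S \<omega>, A \<omega>)) \<in> measurable M \<kappa>"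
    unfolding measurable_cong_sets[OF refl \<kappa>(2)] by measurable
  have WSA: "(\<lambda>\<omega>. (W \<omega>, (S \<omega>, A \<omega>))) \<in> measurable ?J (borel \<Otimes>\<^sub>M \<kappa>)"
    by (intro measurable_on_state measurable_Pair SA meas(1))
  show ?thesis
  proof (rule pair_measure_eqI[symmetric])
    show "sigma_finite_measure ?D" "sigma_finite_measure \<kappa>"
      by unfold_locales
    show "sets (?D \<Otimes>\<^sub>M \<kappa>) = sets (distr ?J (borel \<Otimes>\<^sub>M \<kappa>) (\<lambda>\<omega>. (W \<omega>, (S \<omega>, A \<omega>))))"
      by (simp cong: sets_pair_measure_cong)
    fix B D assume BD: "B \<in> sets ?D" "D \<in> sets \<kappa>"
    then have B: "B \<in> sets borel" and D: "D \<in> sets borel" using \<kappa>(2) by auto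
    have WB: "{\<omega> \<in> space M. W \<omega> \<in> B} \<in> sets M"
      using measurable_sets[OF meas(1) B] by (simp add: vimage_def Int_def conj_commute)
    have SAD: "{\<omega> \<in> space M. (S \<omega>, A \<omega>) \<in> D} \<in> sets M"
      using measurable_sets[OF SA BD(2)] by (simp add: vimage_def Int_def conj_commute)
    have U'D: "{\<omega> \<in> space M. W \<omega> \<in> B \<and> (S \<omega>, A \<omega>) \<in> D} \<in> sets M"
      using sets.Int[OF WB SAD] by (simp add: Int_def conj_ac)
    have sub: "W -` B \<inter> space ?N = {\<omega> \<in> space M. W \<omega> \<in> B} \<inter> space ?N"
      by (auto simp: space_on_state)
    have "emeasure ?D B = p * emeasure M {\<omega> \<in> space M. W \<omega> \<in> B \<and> U \<omega> = i}"
      using B emeasure_on_state[OF meas(4) WB, of i]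
      by (simp add: emeasure_density_const emeasure_distr[OF WN] sub)
    moreover have "emeasure (distr ?J (borel \<Otimes>\<^sub>M \<kappa>) (\<lambda>\<omega>. (W \<omega>, (S \<omega>, A \<omega>)))) (B \<times> D) =
      emeasure M {\<omega> \<in> space M. W \<omega> \<in> B \<and> (S \<omega>, A \<omega>) \<in> D \<and> U \<omega> = i \<and> U' \<omega> = j}"
    proof -
      let ?E = "{\<omega> \<in> space M. W \<omega> \<in> B \<and> (S \<omega>, A \<omega>) \<in> D}"
      have E: "{\<omega> \<in> space (on_state M U' j). W \<omega> \<in> B \<and> (S \<omega>, A \<omega>) \<in> D} =
          ?E \<inter> space (on_state M U' j)"
        by (auto simp: space_on_state)
      have E': "?E \<inter> space (on_state M U' j) \<in> sets (on_state M U' j)"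
        using measurable_sets[OF measurable_on_state[OF measurable_ident], OF U'D] by (simp add: vimage_def)
      have "(\<lambda>\<omega>. (W \<omega>, (S \<omega>, A \<omega>))) -` (B \<times> D) \<inter> space ?J =
          (?E \<inter> space (on_state M U' j)) \<inter> space ?J"
        by (auto simp: space_on_state)
      then have "emeasure (distr ?J (borel \<Otimes>\<^sub>M \<kappa>) (\<lambda>\<omega>. (W \<omega>, (S \<omega>, A \<omega>)))) (B \<times> D) =
          emeasure (on_state M U' j) {\<omega> \<in> ?E \<inter> space (on_state M U' j). U \<omega> = i}"
        using BD emeasure_on_state[OF measurable_on_state[OF meas(4)] E', of i]
        by (simp add: emeasure_distr[OF WSA])
      also have "{\<omega> \<in> ?E \<inter> space (on_state M U' j). U \<omega> = i} =
          {\<omega> \<in> ?E. U \<omega> = i} \<inter> space (on_state M U' j)" by auto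
      also have "emeasure (on_state M U' j) \<dots> = emeasure M {\<omega> \<in> {\<omega> \<in> ?E. U \<omega> = i}. U' \<omega> = j}"
        by (rule emeasure_on_state[OF meas(5)])
          (use sets.Int[OF U'D state_event[OF meas(4), of i]] in \<open>simp add: Int_def conj_ac\<close>)
      also have "{\<omega> \<in> {\<omega> \<in> ?E. U \<omega> = i}. U' \<omega> = j} =
         {\<omega> \<in> space M. W \<omega> \<in> B \<and> (S \<omega>, A \<omega>) \<in> D \<and> U \<omega> = i \<and> U' \<omega> = j}" by auto
      finally show ?thesis .
    qed
    ultimately show "emeasure ?D B * emeasure \<kappa> D =
        emeasure (distr ?J (borel \<Otimes>\<^sub>M \<kappa>) (\<lambda>\<omega>. (W \<omega>, (S \<omega>, A \<omega>)))) (B \<times> D)"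
      using rect[OF B D] p
      by (simp add: M.emeasure_eq_measure \<kappa>.emeasure_eq_measure ennreal_mult)
  qed
qed

lemma integral_joint_law:
  fixes W S A :: "'w \<Rightarrow> real" and U U' :: "'w \<Rightarrow> 'n" and \<kappa> :: "(real \<times> real) measure" and p :: real
    and h :: "real \<times> real \<times> real \<Rightarrow> complex"
  assumes M: "prob_space M"
    and meas: "W \<in> borel_measurable M" "S \<in> borel_measurable M" "A \<in> borel_measurable M"
      "U \<in> measurable M (count_space UNIV)" "U' \<in> measurable M (count_space UNIV)"
    and \<kappa>: "prob_space \<kappa>" "sets \<kappa> = sets borel" and p: "0 \<le> p"
    and rect: "\<And>B D. B \<in> sets borel \<Longrightarrow> D \<in> sets borel \<Longrightarrow>
       measure M {\<omega> \<in> space M. W \<omega> \<in> B \<and> (S \<omega>, A \<omega>) \<in> D \<and> U \<omega> = i \<and> U' \<omega> = j} =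
       p * measure M {\<omega> \<in> space M. W \<omega> \<in> B \<and> U \<omega> = i} * measure \<kappa> D"
    and h: "h \<in> borel_measurable borel"
  shows "(LINT \<omega>|M. h (W \<omega>, S \<omega>, A \<omega>) * of_bool (U \<omega> = i \<and> U' \<omega> = j)) =
    p * (LINT (\<omega>, v)|(on_state M U i \<Otimes>\<^sub>M \<kappa>). h (W \<omega>, v))"
proof -
  interpret M: prob_space M by fact
  interpret \<kappa>: prob_space \<kappa> by fact
  let ?N = "on_state M U i"
  let ?D = "density (distr ?N borel W) (\<lambda>_. p)"
  let ?J = "on_state (on_state M U' j) U i"
  interpret N: finite_measure ?N
    by (rule finite_measure_on_state[OF M.finite_measure_axioms meas(4)])
  have WN: "W \<in> borel_measurable ?N" by (rule measurable_on_state[OF meas(1)])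
  interpret dist: finite_measure "distr ?N borel W" by (rule N.finite_measure_distr[OF WN])
  note [measurable_cong] = \<kappa>(2)
  note [measurable] = meas
  have sets: "sets (borel \<Otimes>\<^sub>M \<kappa>) = sets (borel :: (real \<times> real \<times> real) measure)"
  proof -
    have "sets ((borel :: real measure) \<Otimes>\<^sub>M \<kappa>) = sets (borel \<Otimes>\<^sub>M (borel :: (real \<times> real) measure))"
      by (intro sets_pair_measure_cong \<kappa>(2) refl)
    then show ?thesis unfolding borel_prod .
  qed
  have h': "h \<in> borel_measurable (borel \<Otimes>\<^sub>M \<kappa>)"
    using h by (simp add: measurable_cong_sets[OF sets refl])
  have SA: "(\<lambda>\<omega>. (S \<omega>, A \<omega>)) \<in> measurable M \<kappa>"
    unfolding measurable_cong_sets[OF refl \<kappa>(2)] by measurable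
  have WSA: "(\<lambda>\<omega>. (W \<omega>, (S \<omega>, A \<omega>))) \<in> measurable ?J (borel \<Otimes>\<^sub>M \<kappa>)"
    by (intro measurable_on_state measurable_Pair SA meas(1))
  have eq: "density (distr ?N borel W) (\<lambda>_. p) \<Otimes>\<^sub>M \<kappa> =
     density (distr (?N \<Otimes>\<^sub>M \<kappa>) (borel \<Otimes>\<^sub>M \<kappa>) (\<lambda>(\<omega>, v). (W \<omega>, v))) (\<lambda>_. p)"
  proof -
    have "?D \<Otimes>\<^sub>M \<kappa> = ?D \<Otimes>\<^sub>M density \<kappa> (\<lambda>_. 1)"
      by (simp add: density_1)
    also have "\<dots> = density (distr ?N borel W \<Otimes>\<^sub>M \<kappa>) (\<lambda>(x, y). ennreal p * 1)"
      by (rule pair_measure_density)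
        (auto simp: density_1 intro: \<kappa>.sigma_finite_measure_axioms)
    also have "distr ?N borel W \<Otimes>\<^sub>M \<kappa> = distr ?N borel W \<Otimes>\<^sub>M distr \<kappa> \<kappa> (\<lambda>v. v)"
      by (simp add: distr_id)
    also have "\<dots> = distr (?N \<Otimes>\<^sub>M \<kappa>) (borel \<Otimes>\<^sub>M \<kappa>) (\<lambda>(\<omega>, v). (W \<omega>, v))"
      by (rule pair_measure_distr[OF WN])
        (auto simp: distr_id intro: \<kappa>.sigma_finite_measure_axioms)
    finally show ?thesis by (simp add: split_beta')
  qed
  have F: "(\<lambda>x. (W (fst x), snd x)) \<in> measurable (?N \<Otimes>\<^sub>M \<kappa>) (borel \<Otimes>\<^sub>M \<kappa>)"
    by (intro measurable_Pair measurable_compose[OF measurable_fst WN] measurable_snd)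
  have "(LINT \<omega>|M. h (W \<omega>, S \<omega>, A \<omega>) * of_bool (U \<omega> = i \<and> U' \<omega> = j)) =
     (LINT \<omega>|?J. h (W \<omega>, S \<omega>, A \<omega>))"
    unfolding integral_on_state[OF measurable_on_state[OF meas(4)]] integral_on_state[OF meas(5)]
    by (intro Bochner_Integration.integral_cong) auto
  also have "\<dots> = (LINT v|distr ?J (borel \<Otimes>\<^sub>M \<kappa>) (\<lambda>\<omega>. (W \<omega>, (S \<omega>, A \<omega>))). h v)"
    using h' by (simp add: integral_distr[OF WSA])
  also have "\<dots> = (LINT v|(?D \<Otimes>\<^sub>M \<kappa>). h v)"
    by (subst joint_law_product[OF M meas \<kappa> p rect]) auto
  also have "\<dots> = p * (LINT (\<omega>, v)|(?N \<Otimes>\<^sub>M \<kappa>). h (W \<omega>, v))"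
    unfolding eq using h' p
    by (subst integral_density) (auto simp: integral_distr[OF F] split_beta' scaleR_conv_of_real)
  finally show ?thesis .
qed

section \<open>The transform after one step\<close>

text \<open>The elementary form of the conditional independence: all conditional probabilities are multiplied out.
Conditioning events of probability 0 have to be treated separately, because the hypotheses say nothing
about them; there both sides vanish.\<close>

lemma transition_rectangle:
  fixes W S A :: "'w \<Rightarrow> real" and U U' :: "'w \<Rightarrow> 'n" and \<kappa> :: "(real \<times> real) measure" and p :: real
  assumes M: "prob_space M"
    and meas: "W \<in> borel_measurable M" "S \<in> borel_measurable M" "A \<in> borel_measurable M"
      "U \<in> measurable M (count_space UNIV)" "U' \<in> measurable M (count_space UNIV)"
    and indep: "\<And>B D. measure M {\<omega> \<in> space M. U \<omega> = i} > 0 \<Longrightarrow> B \<in> sets borel \<Longrightarrow> D \<in> sets borel \<Longrightarrow>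
      cond_prob M (\<lambda>\<omega>. W \<omega> \<in> B \<and> (S \<omega>, A \<omega>) \<in> D \<and> U' \<omega> = j) (\<lambda>\<omega>. U \<omega> = i) =
      cond_prob M (\<lambda>\<omega>. W \<omega> \<in> B) (\<lambda>\<omega>. U \<omega> = i) *
      cond_prob M (\<lambda>\<omega>. (S \<omega>, A \<omega>) \<in> D \<and> U' \<omega> = j) (\<lambda>\<omega>. U \<omega> = i)"
    and trans: "measure M {\<omega> \<in> space M. U \<omega> = i} > 0 \<Longrightarrow>
      cond_prob M (\<lambda>\<omega>. U' \<omega> = j) (\<lambda>\<omega>. U \<omega> = i) = p"
    and law: "\<And>D. measure M {\<omega> \<in> space M. U \<omega> = i \<and> U' \<omega> = j} > 0 \<Longrightarrow> D \<in> sets borel \<Longrightarrow>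
      cond_prob M (\<lambda>\<omega>. (S \<omega>, A \<omega>) \<in> D) (\<lambda>\<omega>. U \<omega> = i \<and> U' \<omega> = j) = measure \<kappa> D"
    and BD: "B \<in> sets borel" "D \<in> sets borel"
  shows "measure M {\<omega> \<in> space M. W \<omega> \<in> B \<and> (S \<omega>, A \<omega>) \<in> D \<and> U \<omega> = i \<and> U' \<omega> = j} =
       p * measure M {\<omega> \<in> space M. W \<omega> \<in> B \<and> U \<omega> = i} * measure \<kappa> D"
proof -
  interpret prob_space M by fact
  let ?i = "{\<omega> \<in> space M. U \<omega> = i}"
  let ?ij = "{\<omega> \<in> space M. U \<omega> = i \<and> U' \<omega> = j}"
  have i: "?i \<in> sets M" by (rule state_event[OF meas(4)])
  have ij: "?ij \<in> sets M"
    using sets.Int[OF i state_event[OF meas(5), of j]] by (simp add: Int_def conj_ac)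
  have null: "measure M {\<omega> \<in> space M. Q \<omega>} = 0"
    if "measure M {\<omega> \<in> space M. R \<omega>} = 0" "{\<omega> \<in> space M. R \<omega>} \<in> sets M" "\<And>\<omega>. Q \<omega> \<Longrightarrow> R \<omega>" for Q R
  proof -
    have "measure M {\<omega> \<in> space M. Q \<omega>} \<le> measure M {\<omega> \<in> space M. R \<omega>}"
      using that by (intro finite_measure_mono) auto
    then show ?thesis using that(1) measure_nonneg[of M] by (simp add: antisym)
  qed
  show ?thesis
  proof (cases "measure M ?i = 0")
    case True
    then show ?thesis
      using null[OF True i, of "\<lambda>\<omega>. W \<omega> \<in> B \<and> (S \<omega>, A \<omega>) \<in> D \<and> U \<omega> = i \<and> U' \<omega> = j"]
        null[OF True i, of "\<lambda>\<omega>. W \<omega> \<in> B \<and> U \<omega> = i"] by simp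
  next
    case False
    then have q: "measure M ?i > 0" by (simp add: zero_less_measure_iff)
    have step: "measure M {\<omega> \<in> space M. ((S \<omega>, A \<omega>) \<in> D \<and> U' \<omega> = j) \<and> U \<omega> = i} = p * measure M ?i * measure \<kappa> D"
    proof (cases "measure M ?ij = 0")
      case True
      have "p = 0"
        using trans[OF q] True by (simp add: cond_prob_def conj_commute)
      then show ?thesis
        using null[OF True ij, of "\<lambda>\<omega>. ((S \<omega>, A \<omega>) \<in> D \<and> U' \<omega> = j) \<and> U \<omega> = i"] by simp
    next
      case False
      then have r: "measure M ?ij > 0" by (simp add: zero_less_measure_iff)
      have "measure M {\<omega> \<in> space M. (S \<omega>, A \<omega>) \<in> D \<and> U \<omega> = i \<and> U' \<omega> = j} = measure \<kappa> D * measure M ?ij"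
        using law[OF r BD(2)] r by (simp add: cond_prob_def field_simps)
      moreover have "measure M ?ij = p * measure M ?i"
        using trans[OF q] q by (simp add: cond_prob_def conj_commute field_simps)
      ultimately show ?thesis by (simp add: conj_ac mult_ac)
    qed
    have "measure M {\<omega> \<in> space M. (W \<omega> \<in> B \<and> (S \<omega>, A \<omega>) \<in> D \<and> U' \<omega> = j) \<and> U \<omega> = i} * measure M ?i =
       measure M {\<omega> \<in> space M. W \<omega> \<in> B \<and> U \<omega> = i} *
       measure M {\<omega> \<in> space M. ((S \<omega>, A \<omega>) \<in> D \<and> U' \<omega> = j) \<and> U \<omega> = i}"
      using indep[OF q BD] q by (simp add: cond_prob_def field_simps)
    then have "measure M {\<omega> \<in> space M. (W \<omega> \<in> B \<and> (S \<omega>, A \<omega>) \<in> D \<and> U' \<omega> = j) \<and> U \<omega> = i} =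
       p * measure M {\<omega> \<in> space M. W \<omega> \<in> B \<and> U \<omega> = i} * measure \<kappa> D"
      unfolding step using q by simp
    then show ?thesis by (simp add: conj_ac)
  qed
qed

text \<open>The part of the one-step transform that the reflection at 0 creates, as a function of the value \<open>w\<close>
before the step.\<close>

definition overshoot :: "real \<Rightarrow> (real \<times> real) measure \<Rightarrow> complex \<Rightarrow> real \<Rightarrow> complex" where
  "overshoot a \<kappa> s w = (LINT (x, y)|\<kappa>. 1 - exp (- s * of_real (min 0 (a * w + x - y))))"

lemma norm_one_minus_exp_le:
  assumes "Re s \<le> 0" "t \<le> 0"
  shows "norm (1 - exp (- s * complex_of_real t)) \<le> 2"
proof -
  have "norm (exp (- s * complex_of_real t)) \<le> 1"
    using norm_exp_laplace_le[of "- s" "- t"] assms by simp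
  then show ?thesis
    using norm_triangle_ineq4[of 1 "exp (- s * complex_of_real t)"] unfolding norm_one by linarith
qed

lemma continuous_overshoot:
  assumes "prob_space \<kappa>" and sets: "sets \<kappa> = sets borel" and s: "Re s \<le> 0"
  shows "continuous_on UNIV (overshoot a \<kappa> s)"
proof (rule continuous_on_sequentiallyI)
  interpret \<kappa>: prob_space \<kappa> by fact
  have [measurable_cong]: "sets \<kappa> = sets (borel \<Otimes>\<^sub>M borel)"
    using sets unfolding borel_prod .
  have meas: "(\<lambda>v. 1 - exp (- s * complex_of_real (min 0 (a * w + fst v - snd v)))) \<in> borel_measurable \<kappa>" for w
    by measurable
  fix u :: "nat \<Rightarrow> real" and w assume u: "u \<longlonglongrightarrow> w"
  show "(\<lambda>n. overshoot a \<kappa> s (u n)) \<longlonglongrightarrow> overshoot a \<kappa> s w"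
    unfolding overshoot_def split_beta'
  proof (rule integral_dominated_convergence[where w = "\<lambda>_. 2"])
    show "AE v in \<kappa>. (\<lambda>n. 1 - exp (- s * complex_of_real (min 0 (a * u n + fst v - snd v))))
        \<longlonglongrightarrow> 1 - exp (- s * complex_of_real (min 0 (a * w + fst v - snd v)))"
      by (intro AE_I2 tendsto_intros u)
    show "AE v in \<kappa>. norm (1 - exp (- s * complex_of_real (min 0 (a * u n + fst v - snd v)))) \<le> 2" for n
      using s by (intro AE_I2 norm_one_minus_exp_le) auto
  qed (use meas in simp_all)
qed

text \<open>A step from a large value does not reach 0. Together with continuity this is what allows the passage
to the limit under the law of \<open>W\<close>, even for \<open>s\<close> where \<open>exp (- s w)\<close> itself has no limit at infinity.\<close>

lemma overshoot_tendsto_0: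
  assumes "prob_space \<kappa>" and sets: "sets \<kappa> = sets borel" and s: "Re s \<le> 0" and a: "0 < a"
  shows "(overshoot a \<kappa> s \<longlongrightarrow> 0) at_top"
proof -
  interpret \<kappa>: prob_space \<kappa> by fact
  have [measurable_cong]: "sets \<kappa> = sets (borel \<Otimes>\<^sub>M borel)"
    using sets unfolding borel_prod .
  have meas: "(\<lambda>v. 1 - exp (- s * complex_of_real (min 0 (a * w + fst v - snd v)))) \<in> borel_measurable \<kappa>" for w
    by measurable
  have "((\<lambda>w. overshoot a \<kappa> s w) \<longlongrightarrow> (LINT v|\<kappa>. 0)) at_top"
    unfolding overshoot_def split_beta'
  proof (rule integral_dominated_convergence_at_top[where w = "\<lambda>_. 2"])
    show "AE v in \<kappa>. ((\<lambda>w. 1 - exp (- s * complex_of_real (min 0 (a * w + fst v - snd v)))) \<longlongrightarrow> 0) at_top"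
    proof (intro AE_I2 tendsto_eventually)
      fix v :: "real \<times> real"
      have "eventually (\<lambda>w. w \<ge> (snd v - fst v) / a) at_top" by (rule eventually_ge_at_top)
      then show "eventually (\<lambda>w. 1 - exp (- s * complex_of_real (min 0 (a * w + fst v - snd v))) = 0) at_top"
        by eventually_elim (use a in \<open>simp add: pos_divide_le_eq mult.commute\<close>)
    qed
    show "\<forall>\<^sub>F w in at_top. AE v in \<kappa>. norm (1 - exp (- s * complex_of_real (min 0 (a * w + fst v - snd v)))) \<le> 2"
      using s by (intro always_eventually allI AE_I2 norm_one_minus_exp_le) auto
  qed (use meas in simp_all)
  then show ?thesis by simp
qed

lemma integral_overshoot:
  assumes N: "finite_measure N" and X[measurable]: "X \<in> borel_measurable N"
    and \<kappa>: "prob_space \<kappa>" and sets: "sets \<kappa> = sets borel" and s: "Re s \<le> 0"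
  shows "integrable (N \<Otimes>\<^sub>M \<kappa>) (\<lambda>(\<omega>, x, y). 1 - exp (- s * complex_of_real (min 0 (a * X \<omega> + x - y))))"
    and "(LINT (\<omega>, x, y)|(N \<Otimes>\<^sub>M \<kappa>). 1 - exp (- s * complex_of_real (min 0 (a * X \<omega> + x - y)))) =
       (LINT \<omega>|N. overshoot a \<kappa> s (X \<omega>))"
proof -
  interpret N: finite_measure N by fact
  interpret \<kappa>: prob_space \<kappa> by fact
  interpret pair_sigma_finite N \<kappa> by unfold_locales
  interpret NK: finite_measure "N \<Otimes>\<^sub>M \<kappa>"
    by (rule finite_measure_pair_measure[OF \<kappa>.finite_measure_axioms N])
  have [measurable_cong]: "sets \<kappa> = sets (borel \<Otimes>\<^sub>M borel)"
    using sets unfolding borel_prod .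
  have meas: "(\<lambda>v. 1 - exp (- s * complex_of_real (min 0 (a * X (fst v) + fst (snd v) - snd (snd v)))))
      \<in> borel_measurable (N \<Otimes>\<^sub>M \<kappa>)"
    by measurable
  show int: "integrable (N \<Otimes>\<^sub>M \<kappa>) (\<lambda>(\<omega>, x, y). 1 - exp (- s * complex_of_real (min 0 (a * X \<omega> + x - y))))"
    unfolding split_beta'
    by (rule NK.integrable_const_bound[where B = 2, OF AE_I2 meas])
      (rule norm_one_minus_exp_le, use s in auto)
  show "(LINT (\<omega>, x, y)|(N \<Otimes>\<^sub>M \<kappa>). 1 - exp (- s * complex_of_real (min 0 (a * X \<omega> + x - y)))) =
       (LINT \<omega>|N. overshoot a \<kappa> s (X \<omega>))"
    using integral_fst'[OF int] by (simp add: overshoot_def)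
qed

lemma integral_shift_product:
  assumes N: "finite_measure N" and X[measurable]: "X \<in> borel_measurable N"
    and \<kappa>: "prob_space \<kappa>" and sets: "sets \<kappa> = sets borel" and s: "Re s = 0"
  shows "integrable (N \<Otimes>\<^sub>M \<kappa>) (\<lambda>(\<omega>, x, y). exp (- s * complex_of_real (a * X \<omega> + x - y)))"
    and "(LINT (\<omega>, x, y)|(N \<Otimes>\<^sub>M \<kappa>). exp (- s * complex_of_real (a * X \<omega> + x - y))) =
       laplace N X (of_real a * s) * (LINT (x, y)|\<kappa>. exp (- s * complex_of_real (x - y)))"
proof -
  interpret N: finite_measure N by fact
  interpret \<kappa>: prob_space \<kappa> by fact
  interpret pair_sigma_finite N \<kappa> by unfold_locales
  interpret NK: finite_measure "N \<Otimes>\<^sub>M \<kappa>"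
    by (rule finite_measure_pair_measure[OF \<kappa>.finite_measure_axioms N])
  have [measurable_cong]: "sets \<kappa> = sets (borel \<Otimes>\<^sub>M borel)"
    using sets unfolding borel_prod .
  have meas: "(\<lambda>v. exp (- s * complex_of_real (a * X (fst v) + fst (snd v) - snd (snd v))))
      \<in> borel_measurable (N \<Otimes>\<^sub>M \<kappa>)"
    by measurable
  show int: "integrable (N \<Otimes>\<^sub>M \<kappa>) (\<lambda>(\<omega>, x, y). exp (- s * complex_of_real (a * X \<omega> + x - y)))"
    unfolding split_beta'
    by (rule NK.integrable_const_bound[where B = 1, OF AE_I2 meas]) (simp add: s norm_exp_eq_Re)
  have split: "exp (- s * complex_of_real (a * w + x - y)) =
      exp (- (of_real a * s) * complex_of_real w) * exp (- s * complex_of_real (x - y))" for w x y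
    by (simp add: exp_add[symmetric] algebra_simps)
  show "(LINT (\<omega>, x, y)|(N \<Otimes>\<^sub>M \<kappa>). exp (- s * complex_of_real (a * X \<omega> + x - y))) =
       laplace N X (of_real a * s) * (LINT (x, y)|\<kappa>. exp (- s * complex_of_real (x - y)))"
    using integral_fst'[OF int, symmetric] unfolding split laplace_def split_beta'
    by simp
qed

lemma exp_max_0:
  "exp (- s * complex_of_real (max 0 t)) = exp (- s * complex_of_real t) + (1 - exp (- s * complex_of_real (min 0 t)))"
  by (cases "t \<ge> 0") auto

text \<open>On the imaginary axis \<open>exp (- s max 0 t) = exp (- s t) + (1 - exp (- s min 0 t))\<close> splits the transform
after a step into bounded parts: the first factorizes by independence, the second is the overshoot.\<close>

lemma transition_transform:
  fixes W S A W' :: "'w \<Rightarrow> real" and U U' :: "'w \<Rightarrow> 'n::finite" and \<kappa> :: "'n \<Rightarrow> (real \<times> real) measure" and p :: "'n \<Rightarrow> real"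
  assumes M: "prob_space M"
    and meas: "W \<in> borel_measurable M" "S \<in> borel_measurable M" "A \<in> borel_measurable M"
      "U \<in> measurable M (count_space UNIV)" "U' \<in> measurable M (count_space UNIV)"
    and \<kappa>: "\<And>i. prob_space (\<kappa> i)" "\<And>i. sets (\<kappa> i) = sets borel" and p: "\<And>i. 0 \<le> p i"
    and rect: "\<And>i B D. B \<in> sets borel \<Longrightarrow> D \<in> sets borel \<Longrightarrow>
       measure M {\<omega> \<in> space M. W \<omega> \<in> B \<and> (S \<omega>, A \<omega>) \<in> D \<and> U \<omega> = i \<and> U' \<omega> = j} =
       p i * measure M {\<omega> \<in> space M. W \<omega> \<in> B \<and> U \<omega> = i} * measure (\<kappa> i) D"
    and W': "\<And>\<omega>. \<omega> \<in> space M \<Longrightarrow> W' \<omega> = max 0 (a * W \<omega> + S \<omega> - A \<omega>)"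
    and s: "Re s = 0"
  shows "transform_on M W' U' j s =
    (\<Sum>i\<in>UNIV. of_real (p i) *
      (transform_on M W U i (of_real a * s) * (LINT (x, y)|\<kappa> i. exp (- s * of_real (x - y))) +
       (LINT \<omega>|on_state M U i. overshoot a (\<kappa> i) s (W \<omega>))))"
proof -
  interpret prob_space M by fact
  define h where "h v = (case v of (w, x, y) \<Rightarrow> exp (- s * complex_of_real (max 0 (a * w + x - y))))"
    for v :: "real \<times> real \<times> real"
  have h: "h \<in> borel_measurable borel"
    unfolding h_def split_beta' by (intro borel_measurable_continuous_onI continuous_intros)
  have bound: "norm (h v) \<le> 1" for v
    using s by (auto simp: h_def split_beta' norm_exp_eq_Re)
  note [measurable] = meas
  have int: "integrable M (\<lambda>\<omega>. h (W \<omega>, S \<omega>, A \<omega>) * of_bool (U \<omega> = i \<and> U' \<omega> = j))" for i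
  proof (rule integrable_const_bound[where B = 1])
    show "AE \<omega> in M. norm (h (W \<omega>, S \<omega>, A \<omega>) * of_bool (U \<omega> = i \<and> U' \<omega> = j)) \<le> 1"
      using bound by (intro AE_I2) (auto simp: norm_mult)
    have "(\<lambda>\<omega>. h (W \<omega>, S \<omega>, A \<omega>)) \<in> borel_measurable M"
      by (rule measurable_compose[OF _ h]) measurable
    moreover have "(\<lambda>\<omega>. of_bool (U \<omega> = i \<and> U' \<omega> = j) :: complex) \<in> borel_measurable M"
      by measurable
    ultimately show "(\<lambda>\<omega>. h (W \<omega>, S \<omega>, A \<omega>) * of_bool (U \<omega> = i \<and> U' \<omega> = j)) \<in> borel_measurable M"
      by (rule borel_measurable_times)
  qed
  have "transform_on M W' U' j s = (LINT \<omega>|M. (\<Sum>i\<in>UNIV. h (W \<omega>, S \<omega>, A \<omega>) * of_bool (U \<omega> = i \<and> U' \<omega> = j)))"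
    unfolding transform_on_def
  proof (intro Bochner_Integration.integral_cong refl)
    fix \<omega> assume "\<omega> \<in> space M"
    have "(\<Sum>i\<in>UNIV. of_bool (U \<omega> = i \<and> U' \<omega> = j)) = (of_bool (U' \<omega> = j) :: complex)"
      by (simp add: of_bool_conj)
    with \<open>\<omega> \<in> space M\<close> show "exp (- s * complex_of_real (W' \<omega>)) * of_bool (U' \<omega> = j) =
        (\<Sum>i\<in>UNIV. h (W \<omega>, S \<omega>, A \<omega>) * of_bool (U \<omega> = i \<and> U' \<omega> = j))"
      by (simp add: W' h_def sum_distrib_left[symmetric])
  qed
  also have "\<dots> = (\<Sum>i\<in>UNIV. LINT \<omega>|M. h (W \<omega>, S \<omega>, A \<omega>) * of_bool (U \<omega> = i \<and> U' \<omega> = j))"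
    by (rule Bochner_Integration.integral_sum) (rule int)
  also have "\<dots> = (\<Sum>i\<in>UNIV. p i * (LINT (\<omega>, v)|(on_state M U i \<Otimes>\<^sub>M \<kappa> i). h (W \<omega>, v)))"
    by (intro sum.cong refl integral_joint_law[OF M meas \<kappa> p rect h])
  also have "\<dots> = (\<Sum>i\<in>UNIV. of_real (p i) *
      (transform_on M W U i (of_real a * s) * (LINT (x, y)|\<kappa> i. exp (- s * of_real (x - y))) +
       (LINT \<omega>|on_state M U i. overshoot a (\<kappa> i) s (W \<omega>))))"
  proof (intro sum.cong refl arg_cong2[where f = "(*)"])
    fix i
    let ?N = "on_state M U i"
    have N: "finite_measure ?N" by (rule finite_measure_on_state[OF finite_measure_axioms meas(4)])
    have X: "W \<in> borel_measurable ?N" by (rule measurable_on_state[OF meas(1)])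
    have s': "Re s \<le> 0" using s by simp
    have "(LINT (\<omega>, v)|(?N \<Otimes>\<^sub>M \<kappa> i). h (W \<omega>, v)) =
        (LINT \<omega>|(?N \<Otimes>\<^sub>M \<kappa> i). (case \<omega> of (\<omega>, x, y) \<Rightarrow> exp (- s * complex_of_real (a * W \<omega> + x - y))) +
          (case \<omega> of (\<omega>, x, y) \<Rightarrow> 1 - exp (- s * complex_of_real (min 0 (a * W \<omega> + x - y)))))"
      by (intro Bochner_Integration.integral_cong refl) (simp only: h_def split_beta' exp_max_0 fst_conv snd_conv)
    then show "(LINT (\<omega>, v)|(?N \<Otimes>\<^sub>M \<kappa> i). h (W \<omega>, v)) =
       transform_on M W U i (of_real a * s) * (LINT (x, y)|\<kappa> i. exp (- s * of_real (x - y))) +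
       (LINT \<omega>|?N. overshoot a (\<kappa> i) s (W \<omega>))"
      using integral_shift_product[OF N X \<kappa>(1)[of i] \<kappa>(2)[of i] s, of a] integral_overshoot[OF N X \<kappa>(1)[of i] \<kappa>(2)[of i] s', of a]
      by (simp add: transform_on_eq_laplace[OF meas(4)])
  qed
  finally show ?thesis .
qed

section \<open>Rational functions and polynomial growth\<close>

text \<open>The cofactor of \<open>g_plus g\<close>; it carries the leading coefficient and the zeros in the open left half-plane,
so that dividing by it is harmless in \<open>Re s \<ge> 0\<close>.\<close>

definition g_minus :: "complex poly \<Rightarrow> complex poly" where
  "g_minus g = smult (lead_coeff g) (\<Prod>z | poly g z = 0 \<and> Re z < 0. [:- z, 1:] ^ order z g)"

lemma g_plus_times_g_minus:
  assumes "g \<noteq> 0"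
  shows "g = g_plus g * g_minus g"
proof -
  let ?R = "{z. poly g z = 0}"
  have fin: "finite ?R" using assms by (rule poly_roots_finite)
  have "g = smult (lead_coeff g) (\<Prod>z\<in>?R. [:- z, 1:] ^ order z g)"
    by (rule complex_poly_decompose[symmetric])
  also have "?R = {z. poly g z = 0 \<and> 0 \<le> Re z} \<union> {z. poly g z = 0 \<and> Re z < 0}"
    by auto
  also have "(\<Prod>z\<in>\<dots>. [:- z, 1:] ^ order z g) = g_plus g * (\<Prod>z | poly g z = 0 \<and> Re z < 0. [:- z, 1:] ^ order z g)"
    unfolding g_plus_def
    by (rule prod.union_disjoint) (auto intro: finite_subset[OF _ fin])
  finally show ?thesis by (simp add: g_minus_def)
qed

lemma g_plus_nonzero: "g \<noteq> 0 \<Longrightarrow> g_plus g \<noteq> 0"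
  using g_plus_times_g_minus by (metis mult_zero_left)

lemma degree_g_plus: "degree (g_plus g) = m_plus g"
proof -
  have "degree (g_plus g) = (\<Sum>z | poly g z = 0 \<and> 0 \<le> Re z. degree ([:- z, 1:] ^ order z g))"
    unfolding g_plus_def by (rule degree_prod_eq_sum_degree) auto
  then show ?thesis by (simp add: m_plus_def degree_linear_power)
qed

lemma poly_g_minus_nonzero:
  assumes "g \<noteq> 0" "0 \<le> Re s"
  shows "poly (g_minus g) s \<noteq> 0"
proof -
  have "finite {z. poly g z = 0 \<and> Re z < 0}"
    using finite_subset[OF _ poly_roots_finite[OF assms(1)]] by auto
  then show ?thesis
    using assms by (auto simp: g_minus_def poly_prod)
qed

lemma filterlim_ii_at_infinity: "filterlim (\<lambda>t. \<i> * complex_of_real t) at_infinity at_top"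
  by (rule tendsto_mult_filterlim_at_infinity[where c = \<i>])
    (auto simp: tendsto_const filterlim_of_real_at_infinity)

text \<open>A bound along the imaginary axis is enough: if the numerator had the larger degree, the quotient would
tend to infinity in every direction, in particular along that axis.\<close>

lemma rational_bounded_at_infinity:
  fixes f g :: "complex poly"
  assumes bound: "\<And>s. Re s = 0 \<Longrightarrow> norm (poly f s / poly g s) \<le> B"
    and nz: "\<And>s. Re s = 0 \<Longrightarrow> poly g s \<noteq> 0"
  obtains C R where "\<And>s. R \<le> norm s \<Longrightarrow> norm (poly f s / poly g s) \<le> C"
proof -
  have "degree f \<le> degree g"
  proof (rule ccontr)
    assume "\<not> degree f \<le> degree g"
    then have lim: "((\<lambda>s. poly g s / poly f s) \<longlongrightarrow> 0) at_infinity"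
      by (intro poly_divide_tendsto_0_at_infinity) simp
    have "f \<noteq> 0" using \<open>\<not> degree f \<le> degree g\<close> by auto
    have "((\<lambda>t. poly g (\<i> * of_real t) / poly f (\<i> * of_real t)) \<longlongrightarrow> 0) at_top"
      by (rule filterlim_compose[OF lim filterlim_ii_at_infinity])
    then have "((\<lambda>t. norm (poly g (\<i> * of_real t) / poly f (\<i> * of_real t)) * B) \<longlongrightarrow> norm (0::complex) * B) at_top"
      by (intro tendsto_intros)
    then have ev: "eventually (\<lambda>t. norm (poly g (\<i> * of_real t) / poly f (\<i> * of_real t)) * B < 1) at_top"
      by (rule order_tendstoD) simp
    have "filterlim (poly f) at_infinity at_infinity"
      using \<open>\<not> degree f \<le> degree g\<close> by (intro filterlim_poly_at_infinity) simp
    from filterlim_compose[OF this filterlim_ii_at_infinity]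
    have "eventually (\<lambda>t. poly f (\<i> * of_real t) \<noteq> 0) at_top"
      by (rule filterlim_at_infinity_imp_eventually_ne)
    with ev have "eventually (\<lambda>t::real. False) at_top"
    proof eventually_elim
      case (elim t)
      let ?s = "\<i> * complex_of_real t"
      have "1 = norm (poly g ?s / poly f ?s) * norm (poly f ?s / poly g ?s)"
        using elim nz[of ?s] by (simp add: norm_mult[symmetric])
      also have "\<dots> \<le> norm (poly g ?s / poly f ?s) * B"
        by (intro mult_left_mono bound) auto
      finally show False using elim by simp
    qed
    then show False by simp
  qed
  have "g \<noteq> 0" using nz[of 0] by auto
  have "\<exists>L. ((\<lambda>s. poly f s / poly g s) \<longlongrightarrow> L) at_infinity"
  proof (cases "degree f = degree g")
    case True
    have "((\<lambda>s. (poly f s / s ^ degree g) / (poly g s / s ^ degree g)) \<longlongrightarrow> lead_coeff f / lead_coeff g) at_infinity"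
      using poly_divide_tendsto_aux[of f] poly_divide_tendsto_aux[of g] \<open>g \<noteq> 0\<close> True
      by (intro tendsto_divide) auto
    moreover have "eventually (\<lambda>s. (poly f s / s ^ degree g) / (poly g s / s ^ degree g) = poly f s / poly g s) at_infinity"
      by (rule eventually_mono[OF eventually_not_equal_at_infinity[of 0]]) simp
    ultimately show ?thesis by (blast intro: Lim_transform_eventually)
  next
    case False
    then show ?thesis
      using \<open>degree f \<le> degree g\<close> poly_divide_tendsto_0_at_infinity[of f g] by auto
  qed
  then obtain L where "((\<lambda>s. poly f s / poly g s) \<longlongrightarrow> L) at_infinity" by blast
  then have "eventually (\<lambda>s. dist (poly f s / poly g s) L < 1) at_infinity"
    by (rule tendstoD) simp
  then obtain R where R: "\<And>s. R \<le> norm s \<Longrightarrow> dist (poly f s / poly g s) L < 1"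
    by (auto simp: eventually_at_infinity)
  show ?thesis
  proof (rule that)
    fix s :: complex assume "R \<le> norm s"
    then show "norm (poly f s / poly g s) \<le> norm L + 1"
      using R[of s] norm_triangle_sub[of "poly f s / poly g s" L] by (simp add: dist_norm)
  qed
qed

lemma poly_growth:
  fixes p :: "complex poly"
  obtains B R where "0 \<le> B" "\<And>s. R \<le> norm s \<Longrightarrow> norm (poly p s) \<le> B * norm s ^ degree p"
proof -
  have "eventually (\<lambda>s. dist (poly p s / s ^ degree p) (lead_coeff p) < 1) at_infinity"
    by (rule tendstoD[OF poly_divide_tendsto_aux]) simp
  then have "eventually (\<lambda>s. dist (poly p s / s ^ degree p) (lead_coeff p) < 1 \<and> s \<noteq> 0) at_infinity"
    using eventually_not_equal_at_infinity[of 0] by (rule eventually_conj)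
  then obtain R where R: "\<And>s. R \<le> norm s \<Longrightarrow> dist (poly p s / s ^ degree p) (lead_coeff p) < 1 \<and> s \<noteq> 0"
    by (auto simp: eventually_at_infinity)
  show ?thesis
  proof (rule that)
    fix s :: complex assume s: "R \<le> norm s"
    have "norm (poly p s / s ^ degree p) \<le> norm (lead_coeff p) + 1"
      using R[OF s] norm_triangle_sub[of "poly p s / s ^ degree p" "lead_coeff p"] by (simp add: dist_norm)
    then show "norm (poly p s) \<le> (norm (lead_coeff p) + 1) * norm s ^ degree p"
      using R[OF s] by (simp add: norm_divide norm_power pos_divide_le_eq)
  qed simp
qed

text \<open>Two functions that agree on the imaginary axis continue each other across it, so together they are
entire, and by Liouville's theorem polynomial growth makes them a polynomial. Its constant term is the value of \<open>L\<close> at 0.\<close>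

lemma polynomial_of_two_halves:
  fixes R L :: "complex \<Rightarrow> complex"
  assumes R: "R holomorphic_on {s. 0 < Re s}" "continuous_on {s. 0 \<le> Re s} R"
    and L: "L holomorphic_on {s. Re s < 0}" "continuous_on {s. Re s \<le> 0} L"
    and eq: "\<And>s. Re s = 0 \<Longrightarrow> R s = L s"
    and growth: "\<And>s. 0 \<le> Re s \<Longrightarrow> r \<le> norm s \<Longrightarrow> norm (R s) \<le> B * norm s ^ d"
      "\<And>s. Re s \<le> 0 \<Longrightarrow> r \<le> norm s \<Longrightarrow> norm (L s) \<le> B * norm s ^ d"
    and zero: "L 0 = 0"
  obtains c where "\<And>s. 0 \<le> Re s \<Longrightarrow> R s = (\<Sum>m = 1..d. c m * s ^ m)"
proof -
  define K where "K s = (if 0 \<le> Re s then R s else L s)" for s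
  have cont: "continuous_on UNIV K"
  proof -
    have "continuous_on ({s. 0 \<le> Re s} \<union> {s. Re s \<le> 0}) K"
      unfolding K_def
      by (rule continuous_on_If)
        (use R(2) L(2) eq in \<open>auto intro: closed_halfspace_Re_ge closed_halfspace_Re_le\<close>)
    moreover have "{s. 0 \<le> Re s} \<union> {s. Re s \<le> 0} = UNIV" by auto
    ultimately show ?thesis by simp
  qed
  have "K holomorphic_on UNIV"
  proof (rule holomorphic_on_paste_across_line[where d = 1 and k = 0])
    have "L holomorphic_on (UNIV \<inter> {z. 1 \<bullet> z < 0})"
      using L(1) by (simp add: inner_complex_def)
    then show "K holomorphic_on (UNIV \<inter> {z. 1 \<bullet> z < 0})"
      by (rule holomorphic_transform) (auto simp: K_def inner_complex_def)
    have "R holomorphic_on (UNIV \<inter> {z. 0 < 1 \<bullet> z})"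
      using R(1) by (simp add: inner_complex_def)
    then show "K holomorphic_on (UNIV \<inter> {z. 0 < 1 \<bullet> z})"
      by (rule holomorphic_transform) (auto simp: K_def inner_complex_def)
  qed (use cont in auto)
  moreover have "norm (K s) \<le> B * norm s ^ d" if "r \<le> norm s" for s
    using growth[of s] that by (auto simp: K_def)
  ultimately have K: "K s = (\<Sum>k\<le>d. (deriv ^^ k) K 0 / fact k * s ^ k)" for s
    by (rule Liouville_polynomial)
  have K0: "K 0 = 0" using eq[of 0] zero by (simp add: K_def)
  show ?thesis
  proof (rule that)
    fix s :: complex assume "0 \<le> Re s"
    then have "R s = K s" by (simp add: K_def)
    also have "\<dots> = (\<Sum>k\<in>{1..d}. (deriv ^^ k) K 0 / fact k * s ^ k)"
      unfolding K[of s]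
      by (rule sum.mono_neutral_right) (auto simp: K0 not_le)
    finally show "R s = (\<Sum>m = 1..d. ((deriv ^^ m) K 0 / fact m) * s ^ m)" .
  qed
qed

section \<open>The Wiener--Hopf equation\<close>

lemma overshoot_variable:
  fixes X :: "'a \<Rightarrow> real"
  assumes N: "finite_measure N" and X[measurable]: "X \<in> borel_measurable N"
    and \<kappa>: "prob_space \<kappa>" and sets: "sets \<kappa> = sets borel"
  shows "finite_measure (N \<Otimes>\<^sub>M \<kappa>)"
    and "(\<lambda>(\<omega>, x, y). - min 0 (a * X \<omega> + x - y)) \<in> borel_measurable (N \<Otimes>\<^sub>M \<kappa>)"
proof -
  interpret \<kappa>: prob_space \<kappa> by fact
  have [measurable_cong]: "sets \<kappa> = sets (borel \<Otimes>\<^sub>M borel)"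
    using sets unfolding borel_prod .
  show "finite_measure (N \<Otimes>\<^sub>M \<kappa>)"
    by (rule finite_measure_pair_measure[OF \<kappa>.finite_measure_axioms N])
  show "(\<lambda>(\<omega>, x, y). - min 0 (a * X \<omega> + x - y)) \<in> borel_measurable (N \<Otimes>\<^sub>M \<kappa>)"
    unfolding split_beta' by measurable
qed

text \<open>The overshoot \<open>- min 0 (a X + x - y)\<close> is a nonnegative variable on the product space, evaluated at \<open>- s\<close>.
Hence its contribution continues holomorphically to the left half-plane, whereas the transforms of \<open>W\<close>
live on the right half-plane.\<close>

lemma integral_overshoot_eq_laplace:
  assumes N: "finite_measure N" and X: "X \<in> borel_measurable N"
    and \<kappa>: "prob_space \<kappa>" and sets: "sets \<kappa> = sets borel" and s: "Re s \<le> 0"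
  shows "(LINT \<omega>|N. overshoot a \<kappa> s (X \<omega>)) =
     laplace (N \<Otimes>\<^sub>M \<kappa>) (\<lambda>(\<omega>, x, y). - min 0 (a * X \<omega> + x - y)) 0 -
     laplace (N \<Otimes>\<^sub>M \<kappa>) (\<lambda>(\<omega>, x, y). - min 0 (a * X \<omega> + x - y)) (- s)"
    (is "_ = laplace ?K ?T 0 - _")
proof -
  note K = overshoot_variable(1)[OF N X \<kappa> sets]
  note T = overshoot_variable(2)[OF N X \<kappa> sets, of a]
  have nonneg: "0 \<le> ?T v" for v by (simp add: split_beta')
  have "(LINT \<omega>|N. overshoot a \<kappa> s (X \<omega>)) =
      (LINT v|?K. exp (- 0 * complex_of_real (?T v)) - exp (- (- s) * complex_of_real (?T v)))"
    unfolding integral_overshoot(2)[OF N X \<kappa> sets s, symmetric]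
    by (intro Bochner_Integration.integral_cong refl) (simp add: split_beta')
  also have "\<dots> = laplace ?K ?T 0 - laplace ?K ?T (- s)"
    unfolding laplace_def
    by (rule Bochner_Integration.integral_diff; rule integrable_laplace[OF K T nonneg]) (use s in auto)
  finally show ?thesis .
qed

text \<open>The Wiener--Hopf step. The unknown \<open>U\<close> is holomorphic on the left, everything else on the right once
the zeros of the \<open>g i\<close> in \<open>Re s \<ge> 0\<close> are cleared by the product \<open>G\<close> of the \<open>g_plus (g i)\<close>. Then
\<open>G U\<close> is a polynomial of degree at most \<open>degree G\<close>, the sum of the \<open>m_plus (g i)\<close>; it has no constant
term because \<open>U 0 = 0\<close>.\<close>

lemma boundary_solution:
  fixes f g :: "'n::finite \<Rightarrow> complex poly" and q :: "'n \<Rightarrow> complex" and Z0 U :: "complex \<Rightarrow> complex"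
    and Z :: "'n \<Rightarrow> complex \<Rightarrow> complex"
  assumes Z0: "Z0 holomorphic_on {s. 0 < Re s}" "continuous_on {s. 0 \<le> Re s} Z0"
      "\<And>s. 0 \<le> Re s \<Longrightarrow> norm (Z0 s) \<le> B0"
    and Z: "\<And>i. Z i holomorphic_on {s. 0 < Re s}" "\<And>i. continuous_on {s. 0 \<le> Re s} (Z i)"
      "\<And>i s. 0 \<le> Re s \<Longrightarrow> norm (Z i s) \<le> B i"
    and U: "U holomorphic_on {s. Re s < 0}" "continuous_on {s. Re s \<le> 0} U"
      "\<And>s. Re s \<le> 0 \<Longrightarrow> norm (U s) \<le> B1" "U 0 = 0"
    and fg: "\<And>i s. Re s = 0 \<Longrightarrow> poly (g i) s \<noteq> 0"
      "\<And>i s. Re s = 0 \<Longrightarrow> norm (poly (f i) s / poly (g i) s) \<le> 1"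
    and a: "0 < (a :: real)"
    and eq: "\<And>s. Re s = 0 \<Longrightarrow>
       Z0 s = (\<Sum>i\<in>UNIV. q i * (poly (f i) s / poly (g i) s) * Z i (of_real a * s)) + U s"
  obtains c where "\<And>s. 0 \<le> Re s \<Longrightarrow> (\<And>i. poly (g i) s \<noteq> 0) \<Longrightarrow>
    Z0 s = (\<Sum>i\<in>UNIV. q i * (poly (f i) s / poly (g i) s) * Z i (of_real a * s)) +
      (\<Sum>m = 1..(\<Sum>i\<in>UNIV. m_plus (g i)). c m * s ^ m) / (\<Prod>i\<in>UNIV. poly (g_plus (g i)) s)"
proof -
  have g0: "g i \<noteq> 0" for i using fg(1)[of 0 i] by auto
  define G where "G = (\<Prod>i\<in>UNIV. g_plus (g i))"
  define G' where "G' i = (\<Prod>k\<in>UNIV - {i}. g_plus (g k))" for i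
  define d where "d = (\<Sum>i\<in>UNIV. m_plus (g i))"
  define F where "F s = (\<Sum>i\<in>UNIV. q i * (poly (f i) s / poly (g i) s) * Z i (of_real a * s))" for s
  (* G times (Z0 - F) with the cancelled factors removed: it makes sense at the zeros of g i, too. *)
  define R where "R s = poly G s * Z0 s -
    (\<Sum>i\<in>UNIV. q i * (poly (G' i) s * poly (f i) s / poly (g_minus (g i)) s) * Z i (of_real a * s))" for s
  have G_split: "G = g_plus (g i) * G' i" for i
    unfolding G_def G'_def by (rule prod.remove) auto
  have degG: "degree G = d"
    unfolding G_def d_def using g0 g_plus_nonzero
    by (subst degree_prod_eq_sum_degree) (auto simp: degree_g_plus)
  have polyG: "poly G s = (\<Prod>i\<in>UNIV. poly (g_plus (g i)) s)" for s
    by (simp add: G_def poly_prod)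
  have g_split: "poly (g i) s = poly (g_plus (g i)) s * poly (g_minus (g i)) s" for i s
    using arg_cong[OF g_plus_times_g_minus[OF g0[of i]], of "\<lambda>p. poly p s"] by simp
  have R_eq: "R s = poly G s * (Z0 s - F s)" if "\<And>i. poly (g i) s \<noteq> 0" for s
  proof -
    have "q i * (poly (G' i) s * poly (f i) s / poly (g_minus (g i)) s) * Z i (of_real a * s) =
      poly G s * (q i * (poly (f i) s / poly (g i) s) * Z i (of_real a * s))" for i
      using that[of i] unfolding g_split[of i s] G_split[of i] by simp
    then show ?thesis unfolding R_def F_def by (simp add: sum_distrib_left right_diff_distrib)
  qed
  have scale: "(*) (complex_of_real a) ` {s. 0 < Re s} \<subseteq> {s. 0 < Re s}"
    "(*) (complex_of_real a) ` {s. 0 \<le> Re s} \<subseteq> {s. 0 \<le> Re s}"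
    using a by auto
  have holZ: "(\<lambda>s. Z i (of_real a * s)) holomorphic_on {s. 0 < Re s}" for i
    using holomorphic_on_compose_gen[OF _ Z(1) scale(1), of i] by (auto simp: o_def intro!: holomorphic_intros)
  have contZ: "continuous_on {s. 0 \<le> Re s} (\<lambda>s. Z i (of_real a * s))" for i
    by (rule continuous_on_compose2[OF Z(2) _ scale(2)]) (intro continuous_intros)
  have holR: "R holomorphic_on {s. 0 < Re s}"
    unfolding R_def using poly_g_minus_nonzero[OF g0]
    by (intro holomorphic_intros Z0(1) holZ) auto
  have contR: "continuous_on {s. 0 \<le> Re s} R"
    unfolding R_def using poly_g_minus_nonzero[OF g0]
    by (intro continuous_intros Z0(2) contZ) auto
  have holL: "(\<lambda>s. poly G s * U s) holomorphic_on {s. Re s < 0}"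
    by (intro holomorphic_intros U(1))
  have contL: "continuous_on {s. Re s \<le> 0} (\<lambda>s. poly G s * U s)"
    by (intro continuous_intros U(2))
  have agree: "R s = poly G s * U s" if "Re s = 0" for s
    using R_eq[OF fg(1)[OF that]] eq[OF that] by (simp add: F_def)
  have "\<forall>i. \<exists>C r. \<forall>s. r \<le> norm s \<longrightarrow> norm (poly (f i) s / poly (g i) s) \<le> C"
  proof
    fix i
    obtain C r where "\<And>s. r \<le> norm s \<Longrightarrow> norm (poly (f i) s / poly (g i) s) \<le> C"
      using rational_bounded_at_infinity[of "f i" "g i" 1, OF fg(2,1)] by blast
    then show "\<exists>C r. \<forall>s. r \<le> norm s \<longrightarrow> norm (poly (f i) s / poly (g i) s) \<le> C" by blast
  qed
  from choice[OF this] obtain C where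
    "\<forall>i. \<exists>r. \<forall>s. r \<le> norm s \<longrightarrow> norm (poly (f i) s / poly (g i) s) \<le> C i" by blast
  from choice[OF this] obtain r where
    C: "\<And>i s. r i \<le> norm s \<Longrightarrow> norm (poly (f i) s / poly (g i) s) \<le> C i" by blast
  obtain D r1 where D: "0 \<le> D" "\<And>s. r1 \<le> norm s \<Longrightarrow> norm (poly G s) \<le> D * norm s ^ d"
    by (rule poly_growth[of G, unfolded degG]) blast
  have "finite {s. poly (\<Prod>i\<in>UNIV. g i) s = 0}"
    using g0 by (intro poly_roots_finite) simp
  then have "bounded {s. poly (\<Prod>i\<in>UNIV. g i) s = 0}" by (rule finite_imp_bounded)
  then obtain r2 where r2: "\<And>s. poly (\<Prod>i\<in>UNIV. g i) s = 0 \<Longrightarrow> norm s \<le> r2"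
    unfolding bounded_iff by blast
  define r3 where "r3 = Max (insert r1 (insert (r2 + 1) (range r)))"
  define K where "K = B0 + (\<Sum>i\<in>UNIV. norm (q i) * C i * B i)"
  (* Beyond r3 no g i vanishes, so R has the form G (Z0 - F) and F is bounded. *)
  have growthR: "norm (R s) \<le> (D * max K B1) * norm s ^ d" if s: "0 \<le> Re s" "r3 \<le> norm s" for s
  proof -
    have big: "r1 \<le> norm s" "r2 + 1 \<le> norm s" "r i \<le> norm s" for i
      using s(2) by (auto simp: r3_def)
    have nz: "poly (g i) s \<noteq> 0" for i
    proof
      assume "poly (g i) s = 0"
      then have "poly (\<Prod>i\<in>UNIV. g i) s = 0" by (auto simp: poly_prod)
      from r2[OF this] big(2) show False by simp
    qed
    have "norm (F s) \<le> (\<Sum>i\<in>UNIV. norm (q i) * C i * B i)"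
      unfolding F_def
    proof (rule order_trans[OF norm_sum sum_mono])
      fix i
      have C0: "0 \<le> C i" using order_trans[OF norm_ge_zero C[OF big(3)]] .
      show "norm (q i * (poly (f i) s / poly (g i) s) * Z i (of_real a * s)) \<le> norm (q i) * C i * B i"
        unfolding norm_mult using C[OF big(3)[of i]] Z(3)[of "of_real a * s" i] C0 s a
        by (intro mult_mono) (auto simp: norm_mult)
    qed
    then have "norm (Z0 s - F s) \<le> K"
      using norm_triangle_ineq4[of "Z0 s" "F s"] Z0(3)[OF s(1)] unfolding K_def by linarith
    then have "norm (poly G s) * norm (Z0 s - F s) \<le> (D * norm s ^ d) * max K B1"
      using D by (intro mult_mono D(2) big) auto
    then show ?thesis by (simp add: R_eq[OF nz] norm_mult mult_ac)
  qed
  have growthL: "norm (poly G s * U s) \<le> (D * max K B1) * norm s ^ d" if s: "Re s \<le> 0" "r3 \<le> norm s" for s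
  proof -
    have "r1 \<le> norm s" using s(2) by (auto simp: r3_def)
    then have "norm (poly G s) * norm (U s) \<le> (D * norm s ^ d) * max K B1"
      using D U(3)[OF s(1)] by (intro mult_mono D(2)) auto
    then show ?thesis by (simp add: norm_mult mult_ac)
  qed
  obtain c where c: "\<And>s. 0 \<le> Re s \<Longrightarrow> R s = (\<Sum>m = 1..d. c m * s ^ m)"
    using polynomial_of_two_halves[OF holR contR holL contL agree growthR growthL] U(4) by auto
  show ?thesis
  proof (rule that)
    fix s assume s: "0 \<le> Re s" and nz: "\<And>i. poly (g i) s \<noteq> 0"
    have "poly G s \<noteq> 0" using nz unfolding g_split polyG by auto
    then have "Z0 s - F s = R s / poly G s" by (simp add: R_eq[OF nz])
    then show "Z0 s = (\<Sum>i\<in>UNIV. q i * (poly (f i) s / poly (g i) s) * Z i (of_real a * s)) +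
      (\<Sum>m = 1..(\<Sum>i\<in>UNIV. m_plus (g i)). c m * s ^ m) / (\<Prod>i\<in>UNIV. poly (g_plus (g i)) s)"
      unfolding F_def c[OF s] polyG d_def by (simp add: algebra_simps)
  qed
qed

section \<open>Iteration with almost stochastic matrices\<close>

text \<open>The transpose of a stochastic matrix does not increase this norm, so that small perturbations of such
matrices have norm at most \<open>1 + b\<close> with \<open>b\<close> small.\<close>

definition norm1 :: "complex ^ 'n \<Rightarrow> real" where
  "norm1 x = (\<Sum>i\<in>UNIV. norm (x $ i))"

lemma norm_le_norm1: "norm (x :: complex ^ 'n) \<le> norm1 x"
  unfolding norm1_def norm_vec_def by (rule L2_set_le_sum) auto

lemma norm1_nonneg: "0 \<le> norm1 x"
  by (simp add: norm1_def sum_nonneg)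

lemma norm1_mult_le:
  fixes A :: "complex ^ 'n ^ 'n"
  assumes "\<And>i. (\<Sum>j\<in>UNIV. norm (A $ j $ i)) \<le> b"
  shows "norm1 (A *v x) \<le> b * norm1 x"
proof -
  have "norm1 (A *v x) \<le> (\<Sum>j\<in>UNIV. \<Sum>i\<in>UNIV. norm (A $ j $ i) * norm (x $ i))"
    unfolding norm1_def matrix_vector_mult_def
    by (intro sum_mono) (auto intro!: order_trans[OF norm_sum] simp: norm_mult)
  also have "\<dots> = (\<Sum>i\<in>UNIV. (\<Sum>j\<in>UNIV. norm (A $ j $ i)) * norm (x $ i))"
    by (subst sum.swap) (simp add: sum_distrib_right)
  also have "\<dots> \<le> (\<Sum>i\<in>UNIV. b * norm (x $ i))"
    by (intro sum_mono mult_right_mono assms) auto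
  finally show ?thesis by (simp add: norm1_def sum_distrib_left)
qed

lemma mat_prod_Suc_mult: "mat_prod A (Suc n) *v x = mat_prod A n *v (A n *v x)"
  by (simp add: matrix_vector_mul_assoc)

text \<open>The factors \<open>exp (b m)\<close> multiply to \<open>exp\<close> of a sum, hence a summable \<open>b\<close> bounds all partial
products at once.\<close>

lemma norm1_mat_prod_le:
  fixes A :: "nat \<Rightarrow> complex ^ 'n ^ 'n"
  assumes b: "\<And>m x. norm1 (A m *v x) \<le> exp (b m) * norm1 x" and s: "summable b" "\<And>m. 0 \<le> b m"
  shows "norm1 (mat_prod A n *v x) \<le> exp (suminf b) * norm1 x"
proof -
  have "norm1 (mat_prod A n *v x) \<le> exp (\<Sum>m<n. b m) * norm1 x" for x
  proof (induction n arbitrary: x)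
    case (Suc n)
    have "norm1 (mat_prod A (Suc n) *v x) \<le> exp (\<Sum>m<n. b m) * norm1 (A n *v x)"
      unfolding mat_prod_Suc_mult by (rule Suc.IH)
    also have "\<dots> \<le> exp (\<Sum>m<n. b m) * (exp (b n) * norm1 x)"
      by (intro mult_left_mono b) auto
    finally show ?case by (simp add: exp_add mult.assoc)
  qed simp
  also have "exp (\<Sum>m<n. b m) * norm1 x \<le> exp (suminf b) * norm1 x"
    using s by (intro mult_right_mono norm1_nonneg) (auto intro: sum_le_suminf)
  finally show ?thesis by simp
qed

text \<open>Iterating the recursion \<open>n\<close> times leaves the remainder \<open>mat_prod A n *v z n\<close>. Since the products are
bounded, replacing \<open>z n\<close> by its limit \<open>p\<close> does not matter asymptotically, and
\<open>mat_prod A n *v p\<close> converges because \<open>p\<close> is almost fixed by \<open>A m\<close>: its increments are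
\<open>mat_prod A n *v (A n *v p - p)\<close>, which are summable.\<close>

lemma iteration_limit:
  fixes A :: "nat \<Rightarrow> complex ^ 'n ^ 'n" and z v :: "nat \<Rightarrow> complex ^ 'n"
  assumes rec: "\<And>n. z n = A n *v z (Suc n) + v n"
    and cols: "\<And>m i. (\<Sum>j\<in>UNIV. norm (A m $ j $ i)) \<le> 1 + b m"
    and b: "summable b" "\<And>m. 0 \<le> b m"
    and z: "z \<longlonglongrightarrow> p"
    and p: "\<And>m. norm1 (A m *v p - p) \<le> c * b m"
  shows "summable (\<lambda>n. mat_prod A n *v v n)"
    and "convergent (\<lambda>n. mat_prod A (Suc n) *v p)"
    and "z 0 = (\<Sum>n. mat_prod A n *v v n) + lim (\<lambda>n. mat_prod A (Suc n) *v p)"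
proof -
  define E where "E = exp (suminf b)"
  have prod: "norm (mat_prod A n *v x) \<le> E * norm1 x" for n x
  proof -
    have "norm1 (A m *v x) \<le> exp (b m) * norm1 x" for m x
    proof -
      have "norm1 (A m *v x) \<le> (1 + b m) * norm1 x"
        by (rule norm1_mult_le[OF cols])
      also have "\<dots> \<le> exp (b m) * norm1 x"
        by (intro mult_right_mono norm1_nonneg) (simp add: exp_ge_add_one_self)
      finally show ?thesis .
    qed
    from norm1_mat_prod_le[OF this b] show ?thesis
      using norm_le_norm1 order_trans unfolding E_def by blast
  qed
  have "summable (\<lambda>n. mat_prod A n *v (A n *v p - p))"
  proof (rule summable_comparison_test')
    show "summable (\<lambda>n. E * c * b n)" using b by (intro summable_mult)
    show "norm (mat_prod A n *v (A n *v p - p)) \<le> E * c * b n" for n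
      using order_trans[OF prod mult_left_mono[OF p]] by (simp add: E_def mult.assoc)
  qed
  then have "convergent (\<lambda>n. \<Sum>k<n. mat_prod A k *v (A k *v p - p))"
    by (simp add: summable_iff_convergent)
  moreover have "(\<Sum>k<n. mat_prod A k *v (A k *v p - p)) = mat_prod A n *v p - p" for n
  proof -
    have "mat_prod A k *v (A k *v p - p) = mat_prod A (Suc k) *v p - mat_prod A k *v p" for k
      unfolding mat_prod_Suc_mult by (simp add: matrix_vector_mult_diff_distrib)
    then show ?thesis
      using sum_lessThan_telescope[of "\<lambda>k. mat_prod A k *v p" n] by simp
  qed
  ultimately have "convergent (\<lambda>n. mat_prod A n *v p - p)" by simp
  then have "convergent (\<lambda>n. mat_prod A n *v p)" by (simp add: convergent_diff_const_right_iff)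
  then obtain q where q: "(\<lambda>n. mat_prod A n *v p) \<longlonglongrightarrow> q" by (auto simp: convergent_def)
  then have q': "(\<lambda>n. mat_prod A (Suc n) *v p) \<longlonglongrightarrow> q" by (rule LIMSEQ_Suc)
  then show "convergent (\<lambda>n. mat_prod A (Suc n) *v p)" by (rule convergentI)
  have "(\<lambda>n. norm1 (z n - p)) \<longlonglongrightarrow> 0"
  proof -
    have "(\<lambda>n. norm1 (z n - p)) \<longlonglongrightarrow> (\<Sum>i\<in>(UNIV :: 'n set). norm (p $ i - p $ i))"
      unfolding norm1_def vector_minus_component by (intro tendsto_intros z)
    then show ?thesis by simp
  qed
  then have "(\<lambda>n. E * norm1 (z n - p)) \<longlonglongrightarrow> 0" by (rule tendsto_mult_right_zero)
  then have "(\<lambda>n. mat_prod A n *v (z n - p)) \<longlonglongrightarrow> 0"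
    by (rule Lim_null_comparison[rotated]) (simp add: prod)
  from tendsto_add[OF this q] have lim: "(\<lambda>n. mat_prod A n *v z n) \<longlonglongrightarrow> q"
    by (simp add: matrix_vector_mult_diff_distrib)
  have part: "(\<Sum>k<n. mat_prod A k *v v k) = z 0 - mat_prod A n *v z n" for n
  proof (induction n)
    case (Suc n)
    have "mat_prod A n *v z n = mat_prod A (Suc n) *v z (Suc n) + mat_prod A n *v v n"
      unfolding mat_prod_Suc_mult by (subst rec) (rule matrix_vector_right_distrib)
    with Suc show ?case by simp
  qed simp
  have "(\<lambda>n. \<Sum>k<n. mat_prod A k *v v k) \<longlonglongrightarrow> z 0 - q"
    unfolding part by (intro tendsto_intros lim)
  then have sums: "(\<lambda>n. mat_prod A n *v v n) sums (z 0 - q)" by (simp add: sums_def)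
  then show "summable (\<lambda>n. mat_prod A n *v v n)" by (rule sums_summable)
  show "z 0 = (\<Sum>n. mat_prod A n *v v n) + lim (\<lambda>n. mat_prod A (Suc n) *v p)"
    unfolding sums_unique[OF sums, symmetric] limI[OF q'] by simp
qed

text \<open>The polynomial \<open>f - g\<close> vanishes at 0, so the difference of the quotient from 1 has a factor \<open>a ^ n * s\<close>;
the remaining factor converges along the sequence.\<close>

lemma rational_near_one:
  fixes f g :: "complex poly"
  assumes "poly f 0 = poly g 0" and nz: "poly g 0 \<noteq> 0" "\<And>n. poly g (of_real (a ^ n) * s) \<noteq> 0"
    and a: "0 < a" "a < (1::real)"
  obtains C where "0 \<le> C" "\<And>n. norm (poly f (of_real (a ^ n) * s) / poly g (of_real (a ^ n) * s) - 1) \<le> C * a ^ n"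
proof -
  have "poly (f - g) 0 = 0" using assms by simp
  then obtain q where q: "f - g = [:0, 1:] * q"
    using poly_eq_0_iff_dvd[of "f - g" 0] by (auto elim: dvdE)
  let ?u = "\<lambda>n. complex_of_real (a ^ n) * s"
  have u: "?u \<longlonglongrightarrow> 0"
    using tendsto_mult[OF tendsto_of_real[OF LIMSEQ_realpow_zero[of a]] tendsto_const[of s]] a by simp
  have "(\<lambda>n. poly q (?u n) / poly g (?u n)) \<longlonglongrightarrow> poly q 0 / poly g 0"
    using u nz by (intro tendsto_intros) auto
  then have "Bseq (\<lambda>n. poly q (?u n) / poly g (?u n))"
    by (intro convergent_imp_Bseq) (auto simp: convergent_def)
  then obtain B where B: "0 < B" "\<And>n. norm (poly q (?u n) / poly g (?u n)) \<le> B"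
    by (auto simp: Bseq_def)
  show ?thesis
  proof (rule that)
    show "0 \<le> norm s * B" using B by simp
    fix n
    have "poly f (?u n) - poly g (?u n) = ?u n * poly q (?u n)"
      using arg_cong[OF q, of "\<lambda>p. poly p (?u n)"] by simp
    then have "poly f (?u n) / poly g (?u n) - 1 = ?u n * (poly q (?u n) / poly g (?u n))"
      using nz(2)[of n] by (simp add: field_simps)
    also have "norm \<dots> = (a ^ n * norm s) * norm (poly q (?u n) / poly g (?u n))"
      using a by (simp add: norm_mult norm_power norm_divide)
    also have "\<dots> \<le> (a ^ n * norm s) * B"
      using a by (intro mult_left_mono B) auto
    finally show "norm (poly f (?u n) / poly g (?u n) - 1) \<le> norm s * B * a ^ n"
      by (simp add: mult_ac)
  qed
qed

section \<open>The transform of the steady state\<close>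

theorem mainTheorem8:
  fixes a :: real
    and P :: "real ^ ('n::finite) ^ 'n" and \<pi> :: "real ^ 'n"
    and M :: "'w measure"
    and W S A :: "nat \<Rightarrow> 'w \<Rightarrow> real" and Y :: "nat \<Rightarrow> 'w \<Rightarrow> 'n"
    and law :: "'n \<Rightarrow> 'n \<Rightarrow> (real \<times> real) measure"
    and f g :: "'n \<Rightarrow> 'n \<Rightarrow> complex poly"
    and M' :: "'v measure" and W' :: "'v \<Rightarrow> real" and Y' :: "'v \<Rightarrow> 'n"
  assumes a: "0 < a" "a < 1"
    and P: "stochastic_matrix P" "irreducible_matrix P"
    and stationary: "stationary_distribution P \<pi>"
    and M: "prob_space M"
    and W_meas: "\<And>n. W n \<in> borel_measurable M"
    and Y_meas: "\<And>n. Y n \<in> measurable M (count_space UNIV)"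
    and S_meas: "\<And>n. S n \<in> borel_measurable M"
    and A_meas: "\<And>n. A (Suc n) \<in> borel_measurable M"
    and W0_nonneg: "\<And>\<omega>. \<omega> \<in> space M \<Longrightarrow> 0 \<le> W 0 \<omega>"
    and S_nonneg: "\<And>n \<omega>. \<omega> \<in> space M \<Longrightarrow> 0 \<le> S n \<omega>"
    and A_nonneg: "\<And>n \<omega>. \<omega> \<in> space M \<Longrightarrow> 0 \<le> A (Suc n) \<omega>"
    and recursion: "\<And>n \<omega>. \<omega> \<in> space M \<Longrightarrow>
        W (Suc n) \<omega> = max 0 (a * W n \<omega> + S n \<omega> - A (Suc n) \<omega>)"
    and cond_indep: "\<And>n i G B. \<lbrakk>prob_space.prob M {\<omega> \<in> space M. Y n \<omega> = i} > 0;
          G \<in> past_events M W Y S A n;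
          B \<in> sets (borel \<Otimes>\<^sub>M borel \<Otimes>\<^sub>M count_space UNIV)\<rbrakk> \<Longrightarrow>
        cond_prob M (\<lambda>\<omega>. \<omega> \<in> G \<and> (A (Suc n) \<omega>, S n \<omega>, Y (Suc n) \<omega>) \<in> B) (\<lambda>\<omega>. Y n \<omega> = i) =
        cond_prob M (\<lambda>\<omega>. \<omega> \<in> G) (\<lambda>\<omega>. Y n \<omega> = i) *
        cond_prob M (\<lambda>\<omega>. (A (Suc n) \<omega>, S n \<omega>, Y (Suc n) \<omega>) \<in> B) (\<lambda>\<omega>. Y n \<omega> = i)"
    and transition: "\<And>n i j. prob_space.prob M {\<omega> \<in> space M. Y n \<omega> = i} > 0 \<Longrightarrow>
        cond_prob M (\<lambda>\<omega>. Y (Suc n) \<omega> = j) (\<lambda>\<omega>. Y n \<omega> = i) = P $ i $ j"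
    and cond_law: "\<And>n i j B.
        \<lbrakk>prob_space.prob M {\<omega> \<in> space M. Y n \<omega> = i \<and> Y (Suc n) \<omega> = j} > 0; B \<in> sets borel\<rbrakk> \<Longrightarrow>
        cond_prob M (\<lambda>\<omega>. (S n \<omega>, A (Suc n) \<omega>) \<in> B) (\<lambda>\<omega>. Y n \<omega> = i \<and> Y (Suc n) \<omega> = j) =
        measure (law i j) B"
    and law_ME: "\<And>i j. bivariate_matrix_exponential (law i j)"
    and fg_coprime: "\<And>i j. coprime (f i j) (g i j)"
    and fg_transform: "\<And>i j s. Re s = 0 \<Longrightarrow>
        poly (g i j) s \<noteq> 0 \<and>
        (LINT (x, y)|law i j. exp (- s * of_real (x - y))) = poly (f i j) s / poly (g i j) s"
    and M': "prob_space M'"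
    and W'_meas: "W' \<in> borel_measurable M'"
    and Y'_meas: "Y' \<in> measurable M' (count_space UNIV)"
    and W'_nonneg: "\<And>\<omega>. \<omega> \<in> space M' \<Longrightarrow> 0 \<le> W' \<omega>"
    and Y'_law: "\<And>i. prob_space.prob M' {\<omega> \<in> space M'. Y' \<omega> = i} = \<pi> $ i"
    and steady_state: "\<And>i s. 0 \<le> Re s \<Longrightarrow>
        (\<lambda>n. transform_on M (W n) (Y n) i s) \<longlonglongrightarrow> transform_on M' W' Y' i s"
  shows "let Z = Z_vec M W Y; H = H_mat P f g in
    \<exists>c :: 'n \<Rightarrow> nat \<Rightarrow> complex.
    (\<forall>s. 0 \<le> Re s \<and> (\<forall>n i j. poly (g i j) (of_real (a ^ n) * s) \<noteq> 0) \<longrightarrow>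
       Z s = H s *v Z (of_real a * s) + V_vec g c s \<and>
       summable (\<lambda>n. mat_prod (\<lambda>d. H (of_real (a ^ d) * s)) n *v V_vec g c (of_real (a ^ n) * s)) \<and>
       convergent (\<lambda>n. mat_prod (\<lambda>m. H (of_real (a ^ m) * s)) (Suc n) *v complex_vec \<pi>) \<and>
       Z s = (\<Sum>n. mat_prod (\<lambda>d. H (of_real (a ^ d) * s)) n *v V_vec g c (of_real (a ^ n) * s)) +
             lim (\<lambda>n. mat_prod (\<lambda>m. H (of_real (a ^ m) * s)) (Suc n) *v complex_vec \<pi>)) \<and>
    Z 0 = complex_vec \<pi>"
proof -
  interpret M: prob_space M by (rule M)
  interpret M': prob_space M' by (rule M')
  have \<kappa>: "prob_space (law i j)" "sets (law i j) = sets borel" for i j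
    using law_ME[of i j] by (auto simp: bivariate_matrix_exponential_def)
  have P_nonneg: "0 \<le> P $ i $ j" and P_sum: "(\<Sum>j\<in>UNIV. P $ i $ j) = 1" for i j
    using P(1) by (auto simp: stochastic_matrix_def)
  define N where "N i = on_state M' Y' i" for i
  define Z where "Z i = laplace (N i) W'" for i
  have N: "finite_measure (N i)" and WN: "W' \<in> borel_measurable (N i)"
    and W'N: "\<And>\<omega>. \<omega> \<in> space (N i) \<Longrightarrow> 0 \<le> W' \<omega>" for i
    unfolding N_def using W'_nonneg
    by (auto intro: finite_measure_on_state[OF M'.finite_measure_axioms Y'_meas]
        measurable_on_state[OF W'_meas] simp: space_on_state)
  have Z_hol: "Z i holomorphic_on {s. 0 < Re s}" for i
    unfolding Z_def by (rule holomorphic_on_laplace[OF N WN W'N])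
  have Z_cont: "continuous_on {s. 0 \<le> Re s} (Z i)" for i
    unfolding Z_def by (rule continuous_on_laplace[OF N WN W'N])
  have Z_bound: "norm (Z i s) \<le> measure (N i) (space (N i))" if "0 \<le> Re s" for i s
    unfolding Z_def by (rule norm_laplace_le[OF N W'N that])
  have transform_Z: "transform_on M' W' Y' i s = Z i s" for i s
    unfolding Z_def N_def by (rule transform_on_eq_laplace[OF Y'_meas])
  have lim_Z: "(\<lambda>n. transform_on M (W n) (Y n) i s) \<longlonglongrightarrow> Z i s" if "0 \<le> Re s" for i s
    using steady_state[OF that] by (simp add: transform_Z)
  have Z_vec: "Z_vec M W Y s = (\<chi> i. Z i s)" if "0 \<le> Re s" for s
    using limI[OF lim_Z[OF that]] by (simp add: Z_vec_def)
  have Z_0: "Z i 0 = of_real (\<pi> $ i)" for i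
  proof -
    have "Z i 0 = of_real (measure (N i) (space (N i)))"
      unfolding Z_def by (rule laplace_0)
    also have "measure (N i) (space (N i)) = measure M' {\<omega> \<in> space M'. Y' \<omega> = i}"
      using emeasure_on_state[OF Y'_meas sets.top, of i]
      by (simp add: N_def measure_def space_on_state Int_def)
    finally show ?thesis by (simp add: Y'_law)
  qed
  have W_nonneg: "0 \<le> W n \<omega>" if "\<omega> \<in> space M" for n \<omega>
    using W0_nonneg recursion that by (cases n) auto

  (* The history enters only through the single event that the current value lies in B. *)
  have rect: "measure M {\<omega> \<in> space M. W n \<omega> \<in> B \<and> (S n \<omega>, A (Suc n) \<omega>) \<in> D \<and> Y n \<omega> = i \<and> Y (Suc n) \<omega> = j} =
      P $ i $ j * measure M {\<omega> \<in> space M. W n \<omega> \<in> B \<and> Y n \<omega> = i} * measure (law i j) D"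
    if "B \<in> sets borel" "D \<in> sets borel" for n i j B D
  proof (rule transition_rectangle[where W = "W n" and S = "S n" and A = "A (Suc n)" and U = "Y n"
        and U' = "Y (Suc n)" and p = "P $ i $ j" and \<kappa> = "law i j"])
    show "prob_space M" by (rule M)
    show "W n \<in> borel_measurable M" "S n \<in> borel_measurable M" "A (Suc n) \<in> borel_measurable M"
      "Y n \<in> measurable M (count_space UNIV)" "Y (Suc n) \<in> measurable M (count_space UNIV)"
      by (rule W_meas S_meas A_meas Y_meas)+
    show "B \<in> sets borel" "D \<in> sets borel" by (rule that)+
    show "cond_prob M (\<lambda>\<omega>. Y (Suc n) \<omega> = j) (\<lambda>\<omega>. Y n \<omega> = i) = P $ i $ j"
      if "measure M {\<omega> \<in> space M. Y n \<omega> = i} > 0"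
      by (rule transition[OF that])
    show "cond_prob M (\<lambda>\<omega>. (S n \<omega>, A (Suc n) \<omega>) \<in> D) (\<lambda>\<omega>. Y n \<omega> = i \<and> Y (Suc n) \<omega> = j) = measure (law i j) D"
      if "measure M {\<omega> \<in> space M. Y n \<omega> = i \<and> Y (Suc n) \<omega> = j} > 0" "D \<in> sets borel" for D
      by (rule cond_law[OF that])
  next
    fix B :: "real set" and D :: "(real \<times> real) set"
    assume pos: "measure M {\<omega> \<in> space M. Y n \<omega> = i} > 0" and B: "B \<in> sets borel" and D: "D \<in> sets borel"
    let ?G = "W n -` B \<inter> space M"
    let ?B = "{v. (fst (snd v), fst v) \<in> D \<and> snd (snd v) = j}"
    have G: "?G \<in> past_events M W Y S A n"
      unfolding past_events_def
      by (intro sigma_sets.Basic UnI1 CollectI exI[of _ n] exI[of _ B] conjI refl order.refl B)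
    have D': "D \<in> sets (borel \<Otimes>\<^sub>M borel)" using D unfolding borel_prod .
    have "{v \<in> space (borel \<Otimes>\<^sub>M borel \<Otimes>\<^sub>M count_space UNIV). (fst (snd v), fst v) \<in> D \<and> snd (snd v) = j}
        \<in> sets (borel \<Otimes>\<^sub>M borel \<Otimes>\<^sub>M count_space UNIV)"
      using D' by measurable
    then have B': "?B \<in> sets (borel \<Otimes>\<^sub>M borel \<Otimes>\<^sub>M count_space UNIV)"
      by (simp add: space_pair_measure)
    show "cond_prob M (\<lambda>\<omega>. W n \<omega> \<in> B \<and> (S n \<omega>, A (Suc n) \<omega>) \<in> D \<and> Y (Suc n) \<omega> = j) (\<lambda>\<omega>. Y n \<omega> = i) =
      cond_prob M (\<lambda>\<omega>. W n \<omega> \<in> B) (\<lambda>\<omega>. Y n \<omega> = i) *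
      cond_prob M (\<lambda>\<omega>. (S n \<omega>, A (Suc n) \<omega>) \<in> D \<and> Y (Suc n) \<omega> = j) (\<lambda>\<omega>. Y n \<omega> = i)"
      using cond_indep[OF pos G B'] by (simp add: cond_prob_def conj_ac cong: conj_cong)
  qed

  define r where "r i j s = poly (f i j) s / poly (g i j) s" for i j s
  (* In the limit of the one-step identity the overshoot is integrated against the steady state. *)
  define U where "U j s = (\<Sum>i\<in>UNIV. of_real (P $ i $ j) * (LINT \<omega>|N i. overshoot a (law i j) s (W' \<omega>)))" for j s
  have boundary: "Z j s = (\<Sum>i\<in>UNIV. of_real (P $ i $ j) * r i j s * Z i (of_real a * s)) + U j s"
    if s: "Re s = 0" for j s
  proof -
    have s': "0 \<le> Re s" "Re s \<le> 0" "0 \<le> Re (of_real a * s)" using s by auto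
    have diff_law: "(LINT (x, y)|law i j. exp (- s * of_real (x - y))) = r i j s" for i
      using fg_transform[OF s, of i j] by (simp add: r_def)
    have step: "transform_on M (W (Suc n)) (Y (Suc n)) j s =
      (\<Sum>i\<in>UNIV. of_real (P $ i $ j) * (transform_on M (W n) (Y n) i (of_real a * s) * r i j s +
         (LINT \<omega>|on_state M (Y n) i. overshoot a (law i j) s (W n \<omega>))))" for n
      unfolding diff_law[symmetric]
    proof (rule transition_transform[where W = "W n" and S = "S n" and A = "A (Suc n)" and U = "Y n"
          and U' = "Y (Suc n)" and p = "\<lambda>i. P $ i $ j" and \<kappa> = "\<lambda>i. law i j"])
      show "prob_space M" by (rule M)
      show "W n \<in> borel_measurable M" "S n \<in> borel_measurable M" "A (Suc n) \<in> borel_measurable M"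
        "Y n \<in> measurable M (count_space UNIV)" "Y (Suc n) \<in> measurable M (count_space UNIV)"
        by (rule W_meas S_meas A_meas Y_meas)+
      show "prob_space (law i j)" "sets (law i j) = sets borel" for i by (rule \<kappa>)+
      show "0 \<le> P $ i $ j" for i by (rule P_nonneg)
      show "W (Suc n) \<omega> = max 0 (a * W n \<omega> + S n \<omega> - A (Suc n) \<omega>)" if "\<omega> \<in> space M" for \<omega>
        by (rule recursion[OF that])
      show "Re s = 0" by (rule s)
    qed (rule rect)
    have over: "(\<lambda>n. LINT \<omega>|on_state M (Y n) i. overshoot a (law i j) s (W n \<omega>))
        \<longlonglongrightarrow> (LINT \<omega>|N i. overshoot a (law i j) s (W' \<omega>))" for i
    proof (rule integral_convergence_of_laplace)
      show "finite_measure (on_state M (Y n) i)" for n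
        by (rule finite_measure_on_state[OF M.finite_measure_axioms Y_meas])
      show "W n \<in> borel_measurable (on_state M (Y n) i)" for n
        by (rule measurable_on_state[OF W_meas])
      show "0 \<le> W n \<omega>" if "\<omega> \<in> space (on_state M (Y n) i)" for n \<omega>
        using that by (auto simp: space_on_state intro: W_nonneg)
      show "(\<lambda>n. laplace (on_state M (Y n) i) (W n) (of_nat k)) \<longlonglongrightarrow> laplace (N i) W' (of_nat k)" for k
        using lim_Z[of "of_nat k" i] by (simp add: transform_on_eq_laplace[OF Y_meas] Z_def)
      show "continuous_on {0..} (overshoot a (law i j) s)"
        using continuous_overshoot[OF \<kappa> s'(2)] by (rule continuous_on_subset) simp
      show "(overshoot a (law i j) s \<longlongrightarrow> 0) at_top"
        by (rule overshoot_tendsto_0[OF \<kappa> s'(2) a(1)])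
    qed (use N WN W'N in auto)
    have "(\<lambda>n. transform_on M (W (Suc n)) (Y (Suc n)) j s) \<longlonglongrightarrow>
      (\<Sum>i\<in>UNIV. of_real (P $ i $ j) * (Z i (of_real a * s) * r i j s +
         (LINT \<omega>|N i. overshoot a (law i j) s (W' \<omega>))))"
      unfolding step by (intro tendsto_intros lim_Z over s')
    with LIMSEQ_Suc[OF lim_Z[OF s'(1), of j]]
    have "Z j s = (\<Sum>i\<in>UNIV. of_real (P $ i $ j) * (Z i (of_real a * s) * r i j s +
         (LINT \<omega>|N i. overshoot a (law i j) s (W' \<omega>))))"
      by (rule LIMSEQ_unique)
    then show ?thesis
      by (simp add: U_def distrib_left sum.distrib mult_ac)
  qed

  have "\<exists>c. \<forall>s. 0 \<le> Re s \<longrightarrow> (\<forall>i. poly (g i j) s \<noteq> 0) \<longrightarrow>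
      Z j s = (\<Sum>i\<in>UNIV. of_real (P $ i $ j) * r i j s * Z i (of_real a * s)) +
      (\<Sum>m = 1..(\<Sum>i\<in>UNIV. m_plus (g i j)). c m * s ^ m) / (\<Prod>i\<in>UNIV. poly (g_plus (g i j)) s)" for j
  proof -
    let ?K = "\<lambda>i. N i \<Otimes>\<^sub>M law i j"
    let ?T = "\<lambda>(\<omega>, x, y). - min 0 (a * W' \<omega> + x - y)"
    note K = overshoot_variable(1)[OF N WN \<kappa>]
    note T = overshoot_variable(2)[OF N WN \<kappa>, where a = a]
    have T0: "0 \<le> ?T v" for v by (simp add: split_beta')
    have U_eq: "U j s = (\<Sum>i\<in>UNIV. of_real (P $ i $ j) * (laplace (?K i) ?T 0 - laplace (?K i) ?T (- s)))"
      if "Re s \<le> 0" for s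
      unfolding U_def by (simp add: integral_overshoot_eq_laplace[OF N WN \<kappa> that])
    have hol: "(\<lambda>s. laplace (?K i) ?T (- s)) holomorphic_on {s. Re s < 0}" for i
    proof -
      have "laplace (?K i) ?T \<circ> uminus holomorphic_on {s. Re s < 0}"
        by (rule holomorphic_on_compose_gen[OF _ holomorphic_on_laplace[OF K T T0]])
          (auto intro!: holomorphic_intros)
      then show ?thesis by (simp add: o_def)
    qed
    have cont: "continuous_on {s. Re s \<le> 0} (\<lambda>s. laplace (?K i) ?T (- s))" for i
      by (rule continuous_on_compose2[OF continuous_on_laplace[OF K T T0]]) (auto intro!: continuous_intros)
    show ?thesis
    proof (rule boundary_solution[where ?Z0.0 = "Z j" and Z = Z and U = "U j" and f = "\<lambda>i. f i j"
          and g = "\<lambda>i. g i j" and q = "\<lambda>i. of_real (P $ i $ j)" and a = a])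
      show "Z j holomorphic_on {s. 0 < Re s}" "continuous_on {s. 0 \<le> Re s} (Z j)" by (rule Z_hol Z_cont)+
      show "norm (Z j s) \<le> measure (N j) (space (N j))" if "0 \<le> Re s" for s by (rule Z_bound[OF that])
      show "Z i holomorphic_on {s. 0 < Re s}" "continuous_on {s. 0 \<le> Re s} (Z i)" for i
        by (rule Z_hol Z_cont)+
      show "norm (Z i s) \<le> measure (N i) (space (N i))" if "0 \<le> Re s" for i s by (rule Z_bound[OF that])
      have "(\<lambda>s. \<Sum>i\<in>UNIV. of_real (P $ i $ j) * (laplace (?K i) ?T 0 - laplace (?K i) ?T (- s)))
          holomorphic_on {s. Re s < 0}"
        by (intro holomorphic_intros hol)
      then show "U j holomorphic_on {s. Re s < 0}"
        by (rule holomorphic_transform) (simp add: U_eq)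
      have "continuous_on {s. Re s \<le> 0}
          (\<lambda>s. \<Sum>i\<in>UNIV. of_real (P $ i $ j) * (laplace (?K i) ?T 0 - laplace (?K i) ?T (- s)))"
        by (intro continuous_intros cont)
      then show "continuous_on {s. Re s \<le> 0} (U j)"
        by (rule continuous_on_eq) (simp add: U_eq)
      show "U j 0 = 0" by (simp add: U_eq)
      show "norm (U j s) \<le> (\<Sum>i\<in>UNIV. \<bar>P $ i $ j\<bar> * (measure (?K i) (space (?K i)) + measure (?K i) (space (?K i))))"
        if "Re s \<le> 0" for s
        unfolding U_eq[OF that]
      proof (rule order_trans[OF norm_sum sum_mono])
        fix i
        have "norm (laplace (?K i) ?T 0 - laplace (?K i) ?T (- s)) \<le>
            measure (?K i) (space (?K i)) + measure (?K i) (space (?K i))"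
          by (rule order_trans[OF norm_triangle_ineq4 add_mono]; rule norm_laplace_le[OF K T0])
            (use that in auto)
        then show "norm (of_real (P $ i $ j) * (laplace (?K i) ?T 0 - laplace (?K i) ?T (- s))) \<le>
           \<bar>P $ i $ j\<bar> * (measure (?K i) (space (?K i)) + measure (?K i) (space (?K i)))"
          by (simp add: norm_mult mult_left_mono)
      qed
      show "poly (g i j) s \<noteq> 0" if "Re s = 0" for i s using fg_transform[OF that] by blast
      show "norm (poly (f i j) s / poly (g i j) s) \<le> 1" if "Re s = 0" for i s
      proof -
        interpret \<kappa>: prob_space "law i j" by (rule \<kappa>)
        have "norm (LINT v|law i j. exp (- s * of_real (fst v - snd v))) \<le> 1 * measure (law i j) (space (law i j))"
          by (rule norm_integral_le_measure[OF \<kappa>.finite_measure_axioms])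
            (use that in \<open>auto simp: norm_exp_eq_Re\<close>)
        then show ?thesis
          using fg_transform[OF that, of i j] by (simp add: split_beta' \<kappa>.prob_space)
      qed
      show "0 < a" by (rule a)
      show "Z j s = (\<Sum>i\<in>UNIV. of_real (P $ i $ j) * (poly (f i j) s / poly (g i j) s) * Z i (of_real a * s)) + U j s"
        if "Re s = 0" for s
        using boundary[OF that] unfolding r_def .
    next
      fix c
      assume "\<And>s. 0 \<le> Re s \<Longrightarrow> (\<And>i. poly (g i j) s \<noteq> 0) \<Longrightarrow>
        Z j s = (\<Sum>i\<in>UNIV. of_real (P $ i $ j) * (poly (f i j) s / poly (g i j) s) * Z i (of_real a * s)) +
        (\<Sum>m = 1..(\<Sum>i\<in>UNIV. m_plus (g i j)). c m * s ^ m) / (\<Prod>i\<in>UNIV. poly (g_plus (g i j)) s)"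
      then show ?thesis unfolding r_def by blast
    qed
  qed
  then have "\<forall>j. \<exists>c. \<forall>s. 0 \<le> Re s \<longrightarrow> (\<forall>i. poly (g i j) s \<noteq> 0) \<longrightarrow>
      Z j s = (\<Sum>i\<in>UNIV. of_real (P $ i $ j) * r i j s * Z i (of_real a * s)) +
      (\<Sum>m = 1..(\<Sum>i\<in>UNIV. m_plus (g i j)). c m * s ^ m) / (\<Prod>i\<in>UNIV. poly (g_plus (g i j)) s)"
    by (rule allI)
  from choice[OF this] obtain c where
    c: "\<And>j s. 0 \<le> Re s \<Longrightarrow> (\<forall>i. poly (g i j) s \<noteq> 0) \<Longrightarrow>
      Z j s = (\<Sum>i\<in>UNIV. of_real (P $ i $ j) * r i j s * Z i (of_real a * s)) +
      (\<Sum>m = 1..(\<Sum>i\<in>UNIV. m_plus (g i j)). c j m * s ^ m) / (\<Prod>i\<in>UNIV. poly (g_plus (g i j)) s)"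
    by blast

  let ?Z = "Z_vec M W Y" and ?H = "H_mat P f g" and ?p = "complex_vec \<pi>"
  have H_entry: "?H s $ j $ i = of_real (P $ i $ j) * r i j s" for s i j
    by (simp add: H_mat_def r_def)
  have Z_step: "?Z s = ?H s *v ?Z (of_real a * s) + V_vec g c s"
    if "0 \<le> Re s" "\<And>i j. poly (g i j) s \<noteq> 0" for s
  proof (unfold vec_eq_iff, rule allI)
    fix j
    show "?Z s $ j = (?H s *v ?Z (of_real a * s) + V_vec g c s) $ j"
      using c[OF that(1), of j] that a
      by (simp add: Z_vec V_vec_def H_mat_def matrix_vector_mult_def r_def)
  qed
  have Z0: "?Z 0 = ?p" by (simp add: Z_vec Z_0 complex_vec_def)
  have "?Z s = ?H s *v ?Z (of_real a * s) + V_vec g c s \<and>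
       summable (\<lambda>n. mat_prod (\<lambda>d. ?H (of_real (a ^ d) * s)) n *v V_vec g c (of_real (a ^ n) * s)) \<and>
       convergent (\<lambda>n. mat_prod (\<lambda>m. ?H (of_real (a ^ m) * s)) (Suc n) *v ?p) \<and>
       ?Z s = (\<Sum>n. mat_prod (\<lambda>d. ?H (of_real (a ^ d) * s)) n *v V_vec g c (of_real (a ^ n) * s)) +
             lim (\<lambda>n. mat_prod (\<lambda>m. ?H (of_real (a ^ m) * s)) (Suc n) *v ?p)"
    if s: "0 \<le> Re s" and nz: "\<And>n i j. poly (g i j) (of_real (a ^ n) * s) \<noteq> 0" for s
  proof -
    let ?s = "\<lambda>n. complex_of_real (a ^ n) * s"
    have Re_s: "0 \<le> Re (?s n)" for n using s a by simp
    have one: "r i j 0 = 1" for i j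
    proof -
      interpret \<kappa>: prob_space "law i j" by (rule \<kappa>)
      show ?thesis using fg_transform[of 0 i j] by (simp add: r_def split_beta' \<kappa>.prob_space)
    qed
    have "\<exists>C. \<forall>n. norm (r i j (?s n) - 1) \<le> C * a ^ n" for i j
    proof -
      have "poly (g i j) 0 \<noteq> 0" using fg_transform[of 0 i j] by simp
      moreover from this have "poly (f i j) 0 = poly (g i j) 0" using one[of i j] by (simp add: r_def)
      ultimately show ?thesis
        using rational_near_one[of "f i j" "g i j" a s] nz a unfolding r_def by metis
    qed
    then have "\<forall>ij. \<exists>C. \<forall>n. norm (r (fst ij) (snd ij) (?s n) - 1) \<le> C * a ^ n" by blast
    from choice[OF this] obtain C' where
      C': "norm (r (fst ij) (snd ij) (?s n) - 1) \<le> C' ij * a ^ n" for ij n by blast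
    define C where "C = Max (insert 0 (range C'))"
    have C: "0 \<le> C" "norm (r i j (?s n) - 1) \<le> C * a ^ n" for i j n
    proof -
      show "0 \<le> C" by (simp add: C_def)
      have "C' (i, j) \<le> C" unfolding C_def by (rule Max_ge) auto
      then show "norm (r i j (?s n) - 1) \<le> C * a ^ n"
        using order_trans[OF C'[of "(i, j)" n] mult_right_mono] a by simp
    qed
    define b where "b n = C * a ^ n" for n
    have b: "summable b" "\<And>m. 0 \<le> b m"
      using a C(1) unfolding b_def by (auto intro!: summable_mult summable_geometric)
    have cols: "(\<Sum>j\<in>UNIV. norm (?H (?s m) $ j $ i)) \<le> 1 + b m" for m i
    proof -
      have "(\<Sum>j\<in>UNIV. norm (?H (?s m) $ j $ i)) \<le> (\<Sum>j\<in>UNIV. P $ i $ j * (1 + b m))"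
      proof (rule sum_mono)
        fix j
        have "norm (r i j (?s m)) \<le> 1 + b m"
          using C(2)[of i j m] norm_triangle_sub[of "r i j (?s m)" 1] by (simp add: b_def)
        then show "norm (?H (?s m) $ j $ i) \<le> P $ i $ j * (1 + b m)"
          unfolding H_entry norm_mult using P_nonneg[of i j] by (simp add: mult_left_mono)
      qed
      then show ?thesis by (simp add: sum_distrib_right[symmetric] P_sum)
    qed
    have \<pi>_inv: "(\<Sum>i\<in>UNIV. P $ i $ j * \<pi> $ i) = \<pi> $ j" for j
      using stationary by (auto simp: stationary_distribution_def vector_matrix_mult_def vec_eq_iff mult.commute)
    (* The stationary vector is fixed by the matrix at 0, which is the transpose of P. *)
    have pert: "norm1 (?H (?s m) *v ?p - ?p) \<le> norm1 ?p * b m" for m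
    proof -
      define D where "D = (\<chi> j i. complex_of_real (P $ i $ j) * (r i j (?s m) - 1))"
      have "?H (?s m) *v ?p - ?p = D *v ?p"
      proof (unfold vec_eq_iff, rule allI)
        fix j
        have "complex_of_real (\<pi> $ j) = of_real (\<Sum>i\<in>UNIV. P $ i $ j * \<pi> $ i)"
          by (simp only: \<pi>_inv)
        also have "\<dots> = (\<Sum>i\<in>UNIV. of_real (P $ i $ j) * of_real (\<pi> $ i))" by simp
        finally have "(?H (?s m) *v ?p - ?p) $ j =
            (\<Sum>i\<in>UNIV. of_real (P $ i $ j) * r i j (?s m) * of_real (\<pi> $ i)) -
            (\<Sum>i\<in>UNIV. of_real (P $ i $ j) * of_real (\<pi> $ i))"
          by (simp only: vector_minus_component matrix_vector_mult_def H_entry complex_vec_def vec_lambda_beta)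
        also have "\<dots> = (D *v ?p) $ j"
          unfolding sum_subtractf[symmetric]
          by (simp add: D_def matrix_vector_mult_def complex_vec_def algebra_simps)
        finally show "(?H (?s m) *v ?p - ?p) $ j = (D *v ?p) $ j" .
      qed
      also have "norm1 \<dots> \<le> b m * norm1 ?p"
      proof (rule norm1_mult_le)
        fix i
        have "(\<Sum>j\<in>UNIV. norm (D $ j $ i)) \<le> (\<Sum>j\<in>UNIV. P $ i $ j * b m)"
          using C(2) P_nonneg by (intro sum_mono) (simp add: D_def norm_mult b_def mult_left_mono)
        then show "(\<Sum>j\<in>UNIV. norm (D $ j $ i)) \<le> b m"
          by (simp add: sum_distrib_right[symmetric] P_sum)
      qed
      finally show ?thesis by (simp add: mult.commute)
    qed
    have lim: "(\<lambda>n. ?Z (?s n)) \<longlonglongrightarrow> ?p"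
    proof -
      have "?s \<longlonglongrightarrow> 0"
        using tendsto_mult[OF tendsto_of_real[OF LIMSEQ_realpow_zero[of a]] tendsto_const[of s]] a by simp
      then have "(\<lambda>n. Z i (?s n)) \<longlonglongrightarrow> Z i 0" for i
        by (rule continuous_on_tendsto_compose[OF Z_cont]) (use Re_s in auto)
      then have "(\<lambda>n. \<chi> i. Z i (?s n)) \<longlonglongrightarrow> (\<chi> i. Z i 0)"
        by (rule tendsto_vec_lambda)
      then show ?thesis using Z_vec[OF Re_s] Z_vec[of 0] Z0 by simp
    qed
    have rec: "?Z (?s n) = ?H (?s n) *v ?Z (?s (Suc n)) + V_vec g c (?s n)" for n
      using Z_step[OF Re_s nz, of n] by (simp add: mult.assoc)
    have start: "?s 0 = s" by simp
    note limit = iteration_limit[where A = "\<lambda>n. ?H (?s n)" and z = "\<lambda>n. ?Z (?s n)"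
        and v = "\<lambda>n. V_vec g c (?s n)" and b = b and p = ?p and c = "norm1 ?p", OF rec cols b lim pert]
    have step: "?Z s = ?H s *v ?Z (of_real a * s) + V_vec g c s"
      by (rule Z_step[OF s]) (use nz[of _ _ 0] in simp)
    show ?thesis
      by (intro conjI step limit(1,2) limit(3)[unfolded start])
  qed
  note main = this
  show ?thesis
    unfolding Let_def
    by (rule exI[of _ c], rule conjI, intro allI impI, erule conjE, rule main, assumption, blast, rule Z0)
qed

end
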